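(* Let $\Gamma$ be a commutative thick weakly distance-regular digraph and $q$ an integer. The configuration C$(q)$ or the configuration D$(q)$ exists if and only if $(1,q-1)$ is mixed.
   Context: All digraphs are finite, simple, strongly connected. $\partial(x,y)$ is the directed distance, $\tilde\partial(x,y)=(\partial(x,y),\partial(y,x))$, $\tilde\partial(\Gamma)$ the set of all such pairs; $\Gamma_{a,b}=\{(x,y)\mid\tilde\partial(x,y)=(a,b)\}$, $\Gamma_{a,b}(x)=\{y\mid(x,y)\in\Gamma_{a,b}\}$. Weakly distance-regular: for $\tilde h,\tilde i,\tilde j\in\tilde\partial(\Gamma)$, the number $p^{\tilde h}_{\tilde i,\tilde j}$ of $z$ with $\tilde\partial(x,z)=\tilde i,\tilde\partial(z,y)=\tilde j$ depends only on $\tilde h=\tilde\partial(x,y)$ (an intersection number involving a pair outside $\tilde\partial(\Gamma)$ is taken as $0$); commutative: $p^{\tilde h}_{\tilde i,\tilde j}=p^{\tilde h}_{\tilde j,\tilde i}$; $k_{\tilde i}=|\Gamma_{\tilde i}(x)|$; thick: $p^{\tilde h}_{\tilde i,\tilde i},p^{\tilde h}_{\tilde i,\tilde i^*}\in\{0,k_{\tilde i}\}$ where $(a,b)^*=(b,a)$. An arc $(u,v)$ is of type $(1,q-1)$ if $\partial(v,u)=q-1$. Such an arc is pure if every circuit (closed directed walk) of length $q$ containing it consists of arcs of type $(1,q-1)$, and mixed otherwise; $(1,q-1)$ is pure if every arc of type $(1,q-1)$ is pure, otherwise mixed. C$(q)$ exists if $p^{(1,q-2)}_{(1,q-1),(1,q-1)}\neq0$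 and $(1,q-2)$ is pure; D$(q)$ exists if $p^{(1,q-1)}_{(1,q-2),(q-2,1)}\ne0$ and $(1,q-2)$ is pure. *)

theory Defs
  imports "Graph_Theory.Pair_Digraph" "Graph_Theory.Digraph_Component" "Graph_Theory.Shortest_Path"
begin

definition ddist :: "'a pair_pre_digraph \<Rightarrow> 'a \<Rightarrow> 'a \<Rightarrow> nat" where
  "ddist G x y = (LEAST n. \<exists>p. pre_digraph.awalk (with_proj G) x p y \<and> length p = n)"

text \<open>Two-way distances are pairs of integers, so that the pairs (1,q-1) and (1,q-2) make sense
  without truncated subtraction for every integer q.\<close>

definition tdist :: "'a pair_pre_digraph \<Rightarrow> 'a \<Rightarrow> 'a \<Rightarrow> int \<times> int" where
  "tdist G x y = (int (ddist G x y), int (ddist G y x))"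

definition tdists :: "'a pair_pre_digraph \<Rightarrow> (int \<times> int) set" where
  "tdists G = {tdist G x y | x y. x \<in> pverts G \<and> y \<in> pverts G}"

definition trel :: "'a pair_pre_digraph \<Rightarrow> int \<times> int \<Rightarrow> ('a \<times> 'a) set" where
  "trel G h = {(x, y). x \<in> pverts G \<and> y \<in> pverts G \<and> tdist G x y = h}"

definition trel_nbrs :: "'a pair_pre_digraph \<Rightarrow> int \<times> int \<Rightarrow> 'a \<Rightarrow> 'a set" where
  "trel_nbrs G h x = {y. (x, y) \<in> trel G h}"

definition num_between ::
  "'a pair_pre_digraph \<Rightarrow> int \<times> int \<Rightarrow> int \<times> int \<Rightarrow> 'a \<Rightarrow> 'a \<Rightarrow> nat" where
  "num_between G i j x y = card {z \<in> pverts G. tdist G x z = i \<and> tdist G z y = j}"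

definition weakly_distance_regular :: "'a pair_pre_digraph \<Rightarrow> bool" where
  "weakly_distance_regular G \<longleftrightarrow> pair_digraph G \<and> strongly_connected (with_proj G) \<and>
     (\<forall>h\<in>tdists G. \<forall>i\<in>tdists G. \<forall>j\<in>tdists G. \<forall>(x, y)\<in>trel G h. \<forall>(x', y')\<in>trel G h.
        num_between G i j x y = num_between G i j x' y')"

text \<open>The intersection number \<open>inter_num G h i j\<close>, with \<open>h\<close> the upper and \<open>i\<close>, \<open>j\<close> the lower
  indices, and the valency are meant for weakly distance-regular digraphs only, where the
  descriptions below are uniquely satisfied (facts \<open>inter_num_eq\<close> and \<open>valency_eq\<close>).\<close>

definition inter_num ::
  "'a pair_pre_digraph \<Rightarrow> int \<times> int \<Rightarrow> int \<times> int \<Rightarrow> int \<times> int \<Rightarrow> nat" where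
  "inter_num G h i j =
     (if h \<in> tdists G \<and> i \<in> tdists G \<and> j \<in> tdists G
      then THE n. \<forall>(x, y)\<in>trel G h. num_between G i j x y = n
      else 0)"

definition valency :: "'a pair_pre_digraph \<Rightarrow> int \<times> int \<Rightarrow> nat" where
  "valency G i = (THE k. \<forall>x\<in>pverts G. card (trel_nbrs G i x) = k)"

definition commutative_wdr :: "'a pair_pre_digraph \<Rightarrow> bool" where
  "commutative_wdr G \<longleftrightarrow>
     (\<forall>h\<in>tdists G. \<forall>i\<in>tdists G. \<forall>j\<in>tdists G. inter_num G h i j = inter_num G h j i)"

definition thick_wdr :: "'a pair_pre_digraph \<Rightarrow> bool" where
  "thick_wdr G \<longleftrightarrow>
     (\<forall>h\<in>tdists G. \<forall>i\<in>tdists G.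
        inter_num G h i i \<in> {0, valency G i} \<and>
        inter_num G h i (prod.swap i) \<in> {0, valency G i})"

text \<open>Types of arcs are indexed by \<open>q\<close>: \<open>arc_type G q\<close>, \<open>pure_arc G q\<close>, \<open>pure_type G q\<close> and
  \<open>mixed_type G q\<close> refer to the type (1,q-1). Circuits are lists of arcs.\<close>

definition arc_type :: "'a pair_pre_digraph \<Rightarrow> int \<Rightarrow> 'a \<times> 'a \<Rightarrow> bool" where
  "arc_type G q e \<longleftrightarrow> e \<in> parcs G \<and> int (ddist G (snd e) (fst e)) = q - 1"

definition circuit :: "'a pair_pre_digraph \<Rightarrow> ('a \<times> 'a) list \<Rightarrow> bool" where
  "circuit G p \<longleftrightarrow> (\<exists>w. pre_digraph.awalk (with_proj G) w p w)"

definition pure_arc :: "'a pair_pre_digraph \<Rightarrow> int \<Rightarrow> 'a \<times> 'a \<Rightarrow> bool" where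
  "pure_arc G q e \<longleftrightarrow>
     (\<forall>p. circuit G p \<and> int (length p) = q \<and> e \<in> set p \<longrightarrow> (\<forall>f\<in>set p. arc_type G q f))"

definition pure_type :: "'a pair_pre_digraph \<Rightarrow> int \<Rightarrow> bool" where
  "pure_type G q \<longleftrightarrow> (\<forall>e. arc_type G q e \<longrightarrow> pure_arc G q e)"

definition mixed_type :: "'a pair_pre_digraph \<Rightarrow> int \<Rightarrow> bool" where
  "mixed_type G q \<longleftrightarrow> \<not> pure_type G q"

definition config_C :: "'a pair_pre_digraph \<Rightarrow> int \<Rightarrow> bool" where
  "config_C G q \<longleftrightarrow> inter_num G (1, q - 2) (1, q - 1) (1, q - 1) \<noteq> 0 \<and> pure_type G (q - 1)"

definition config_D :: "'a pair_pre_digraph \<Rightarrow> int \<Rightarrow> bool" where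
  "config_D G q \<longleftrightarrow> inter_num G (1, q - 1) (1, q - 2) (q - 2, 1) \<noteq> 0 \<and> pure_type G (q - 1)"

lemma ddist_eq_shortest_path:
  assumes "pair_digraph G" "strongly_connected (with_proj G)" "x \<in> pverts G" "y \<in> pverts G"
  shows "ereal (real (ddist G x y)) = wf_digraph.\<mu> (with_proj G) (\<lambda>_. 1) x y"
proof -
  interpret pair_digraph G by fact
  have cost: "awalk_cost (\<lambda>_. 1) p = real (length p)" for p
    by (induct p) auto
  have "x \<rightarrow>\<^sup>*\<^bsub>with_proj G\<^esub> y"
    using assms by (auto simp: strongly_connected_def)
  then obtain p where p: "awalk x p y"
    by (auto simp: reachable_awalk)
  then have "\<exists>n p'. awalk x p' y \<and> length p' = n"
    by blast
  then have "\<exists>p'. awalk x p' y \<and> length p' = ddist G x y"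
    unfolding ddist_def by (rule LeastI_ex)
  then obtain m where m: "awalk x m y" "length m = ddist G x y"
    by blast
  have least: "ddist G x y \<le> length p'" if "awalk x p' y" for p'
    unfolding ddist_def by (rule Least_le) (use that in blast)
  show ?thesis
    unfolding \<mu>_def cost
  proof (rule antisym)
    show "ereal (real (ddist G x y)) \<le> (INF p\<in>{p. awalk x p y}. ereal (real (length p)))"
      by (rule INF_greatest) (simp add: least)
    show "(INF p\<in>{p. awalk x p y}. ereal (real (length p))) \<le> ereal (real (ddist G x y))"
      by (rule INF_lower2[of m]) (simp_all add: m)
  qed
qed

lemma inter_num_eq:
  assumes "weakly_distance_regular G" "i \<in> tdists G" "j \<in> tdists G" "(x, y) \<in> trel G h"
  shows "inter_num G h i j = num_between G i j x y"
proof -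
  have h: "h \<in> tdists G"
    using assms(4) by (auto simp: trel_def tdists_def)
  have const: "num_between G i j x' y' = num_between G i j x y" if "(x', y') \<in> trel G h" for x' y'
    using assms h that unfolding weakly_distance_regular_def by blast
  have "(THE n. \<forall>(x, y)\<in>trel G h. num_between G i j x y = n) = num_between G i j x y"
  proof (rule the_equality)
    show "\<forall>(x', y')\<in>trel G h. num_between G i j x' y' = num_between G i j x y"
      using const by blast
    show "n = num_between G i j x y" if "\<forall>(x', y')\<in>trel G h. num_between G i j x' y' = n" for n
      using bspec[OF that assms(4)] by simp
  qed
  then show ?thesis
    using h assms(2,3) by (simp add: inter_num_def)
qed

lemma ddist_self:
  assumes "x \<in> pverts G"
  shows "ddist G x x = 0"
proof -
  have "pre_digraph.awalk (with_proj G) x [] x"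
    using assms by (simp add: pre_digraph.awalk_def pre_digraph.cas.simps)
  then show ?thesis
    unfolding ddist_def by (intro Least_eq_0) auto
qed

lemma valency_eq:
  assumes "weakly_distance_regular G" "i \<in> tdists G" "x \<in> pverts G"
  shows "valency G i = card (trel_nbrs G i x)"
proof -
  have zero: "(v, v) \<in> trel G (0, 0)" if "v \<in> pverts G" for v
    using that by (simp add: trel_def tdist_def ddist_self)
  have sw: "prod.swap i \<in> tdists G"
    using assms(2) by (fastforce simp: tdists_def tdist_def)
  have "{z \<in> pverts G. tdist G v z = i \<and> tdist G z v = prod.swap i} = trel_nbrs G i v"
    if "v \<in> pverts G" for v
    using that by (auto simp: trel_nbrs_def trel_def tdist_def)
  then have "card (trel_nbrs G i v) = inter_num G (0, 0) i (prod.swap i)" if "v \<in> pverts G" for v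
    using inter_num_eq[OF assms(1,2) sw zero[OF that]] that by (simp add: num_between_def)
  then show ?thesis
    unfolding valency_def using assms(3) by (intro the_equality) auto
qed

end

theory Submission
  imports Defs
begin

text \<open>
  Thickness says that a relation \<open>A\<^sub>n\<close> of arcs of type \<open>(1, n - 1)\<close> is a blown-up permutation:
  \<open>F\<^sub>n = A\<^sub>n A\<^sub>n\<^sup>*\<close> is an equivalence and \<open>F\<^sub>n A\<^sub>n = A\<^sub>n\<close>. Products of these relations
  commute, so whether a sequence of arc types is realised by a circuit depends only on the multiset
  of types, and a circuit through an arc of type \<open>(1, q - 1)\<close> has length at least \<open>q\<close>. Given a
  circuit of length \<open>q\<close> with an arc of type \<open>(1, q - 1)\<close> and one of another type, the ends of
  two consecutive arcs, one of them of type \<open>(1, q - 1)\<close>, are at two-way distance \<open>(1, q - 2)\<close>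
  or \<open>(2, q - 2)\<close>. As each of these pairs is a single relation, products \<open>A\<^sub>q A\<^sub>r\<close>
  and \<open>A\<^sub>q A\<^sub>s\<close> that meet it coincide, hence \<open>r\<close> and \<open>s\<close> are interchangeable in the circuit.
  By induction, a mixed type \<open>r < q\<close> admits C\<open>(r)\<close> or D\<open>(r)\<close>, which lets one shorten products
  involving \<open>A\<^sub>r\<close>; every circuit other than those producing C\<open>(q)\<close> or D\<open>(q)\<close> becomes too short.
\<close>

section \<open>Two-way relations over a thick distance function\<close>

definition two_way :: "'a set \<Rightarrow> ('a \<Rightarrow> 'a \<Rightarrow> nat) \<Rightarrow> nat \<Rightarrow> nat \<Rightarrow> ('a \<times> 'a) set" where
  "two_way V d a b = {(x, y). x \<in> V \<and> y \<in> V \<and> d x y = a \<and> d y x = b}"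

text \<open>The last three assumptions encode constancy of intersection numbers, commutativity and
  thickness through products of relations alone; no counting remains.\<close>

locale thick_distance =
  fixes V :: "'a set" and d :: "'a \<Rightarrow> 'a \<Rightarrow> nat"
  assumes d_eq_0_iff: "x \<in> V \<Longrightarrow> y \<in> V \<Longrightarrow> d x y = 0 \<longleftrightarrow> x = y"
    and triangle: "x \<in> V \<Longrightarrow> y \<in> V \<Longrightarrow> z \<in> V \<Longrightarrow> d x z \<le> d x y + d y z"
    and first_step: "x \<in> V \<Longrightarrow> y \<in> V \<Longrightarrow> d x y = Suc n \<Longrightarrow> \<exists>z\<in>V. d x z = 1 \<and> d z y = n"
    and two_way_regular: "two_way V d a b \<inter> two_way V d i j O two_way V d k l \<noteq> {} \<Longrightarrow>
      two_way V d a b \<subseteq> two_way V d i j O two_way V d k l"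
    and two_way_commute: "two_way V d i j O two_way V d k l \<subseteq> two_way V d k l O two_way V d i j"
    and two_way_thick: "(x, z) \<in> two_way V d i j \<Longrightarrow> (y, z) \<in> two_way V d i j \<Longrightarrow>
      (x, w) \<in> two_way V d i j \<Longrightarrow> (y, w) \<in> two_way V d i j"
begin

abbreviation S :: "nat \<Rightarrow> nat \<Rightarrow> ('a \<times> 'a) set" where
  "S \<equiv> two_way V d"

text \<open>The index is the length of a shortest circuit through the arc. Truncation is harmless:
  \<open>A 0\<close> and \<open>A 1\<close> are both \<open>S 1 0\<close>, which is empty.\<close>

definition A :: "nat \<Rightarrow> ('a \<times> 'a) set" where
  "A n = S 1 (n - 1)"

definition F :: "nat \<Rightarrow> ('a \<times> 'a) set" where
  "F n = A n O (A n)\<inverse>"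

text \<open>Regular relations are the unions of two-way relations, the analogue of 0-1 matrices in
  the adjacency algebra of an association scheme.\<close>

definition regular :: "('a \<times> 'a) set \<Rightarrow> bool" where
  "regular X \<longleftrightarrow> X \<subseteq> V \<times> V \<and> (\<forall>a b. S a b \<inter> X \<noteq> {} \<longrightarrow> S a b \<subseteq> X)"

fun word :: "nat list \<Rightarrow> ('a \<times> 'a) set" where
  "word [] = Id_on V"
| "word (n # ns) = A n O word ns"

definition circ :: "nat list \<Rightarrow> bool" where
  "circ ns \<longleftrightarrow> (\<exists>x. (x, x) \<in> word ns)"

definition pure :: "nat \<Rightarrow> bool" where
  "pure n \<longleftrightarrow> (\<forall>ns. circ ns \<and> length ns = n \<and> n \<in> set ns \<longrightarrow> set ns = {n})"

text \<open>By regularity, nonemptiness together with containment expresses a nonzero intersection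
  number; see \<open>inter_num_meet\<close>.\<close>

definition conf_C :: "nat \<Rightarrow> bool" where
  "conf_C n \<longleftrightarrow> A (n - 1) \<noteq> {} \<and> A (n - 1) \<subseteq> A n O A n \<and> pure (n - 1)"

definition conf_D :: "nat \<Rightarrow> bool" where
  "conf_D n \<longleftrightarrow> A n \<noteq> {} \<and> A n \<subseteq> F (n - 1) \<and> pure (n - 1)"

section \<open>Regular relations and their products\<close>

lemma S_memD: "(x, y) \<in> S a b \<Longrightarrow> x \<in> V \<and> y \<in> V \<and> d x y = a \<and> d y x = b"
  by (simp add: two_way_def)

lemma S_memI: "x \<in> V \<Longrightarrow> y \<in> V \<Longrightarrow> (x, y) \<in> S (d x y) (d y x)"
  by (simp add: two_way_def)

lemma regular_S: "regular (S a b)"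
  by (auto simp: regular_def two_way_def)

lemma regular_A [simp]: "regular (A n)"
  by (simp add: A_def regular_S)

lemma regular_sub: "regular X \<Longrightarrow> X \<subseteq> V \<times> V"
  by (simp add: regular_def)

lemma regularD: "regular X \<Longrightarrow> (x, y) \<in> X \<Longrightarrow> S (d x y) (d y x) \<subseteq> X"
  unfolding regular_def two_way_def by blast

lemma regular_meet: "regular X \<Longrightarrow> (x, y) \<in> S a b \<Longrightarrow> (x, y) \<in> X \<Longrightarrow> S a b \<subseteq> X"
  unfolding regular_def by blast

lemma regular_meet_A: "regular X \<Longrightarrow> (x, y) \<in> A n \<Longrightarrow> (x, y) \<in> X \<Longrightarrow> A n \<subseteq> X"
  unfolding A_def by (rule regular_meet)

text \<open>Refine both factors to the two-way relations of the two steps;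
  \<open>two_way_regular\<close> spreads their product over all of \<open>S a b\<close>.\<close>

lemma regular_comp [simp]:
  assumes X: "regular X" and Y: "regular Y"
  shows "regular (X O Y)"
proof -
  have "S a b \<subseteq> X O Y" if ab: "S a b \<inter> X O Y \<noteq> {}" for a b
  proof -
    obtain x y z where xy: "(x, y) \<in> S a b" and xz: "(x, z) \<in> X" and zy: "(z, y) \<in> Y"
      using ab by auto
    have V: "x \<in> V" "y \<in> V" "z \<in> V"
      using xz zy regular_sub[OF X] regular_sub[OF Y] by auto
    have "S a b \<subseteq> S (d x z) (d z x) O S (d z y) (d y z)"
      by (rule two_way_regular) (use xy S_memI V in blast)
    also have "\<dots> \<subseteq> X O Y"
      using regularD[OF X xz] regularD[OF Y zy] by (rule relcomp_mono)
    finally show ?thesis .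
  qed
  then show ?thesis
    using regular_sub[OF X] regular_sub[OF Y] by (fastforce simp: regular_def)
qed

lemma regular_converse [simp]:
  assumes X: "regular X"
  shows "regular (X\<inverse>)"
proof -
  have "S a b \<subseteq> X\<inverse>" if "S a b \<inter> X\<inverse> \<noteq> {}" for a b
  proof -
    have "S b a \<inter> X \<noteq> {}"
      using that by (auto simp: two_way_def)
    then have "S b a \<subseteq> X"
      using X by (simp add: regular_def)
    then show ?thesis
      by (auto simp: two_way_def)
  qed
  then show ?thesis
    using regular_sub[OF X] by (auto simp: regular_def)
qed

lemma regular_Id [simp]: "regular (Id_on V)"
proof -
  have "S a b \<subseteq> Id_on V" if ab: "S a b \<inter> Id_on V \<noteq> {}" for a b
  proof -
    obtain x where "(x, x) \<in> S a b"
      using ab by auto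
    then have "a = 0"
      using d_eq_0_iff[of x x] S_memD by fastforce
    then show ?thesis
      using d_eq_0_iff by (auto simp: two_way_def)
  qed
  then show ?thesis
    by (auto simp: regular_def)
qed

lemma regular_F [simp]: "regular (F n)"
  by (simp add: F_def)

lemma regular_word [simp]: "regular (word ns)"
  by (induction ns) auto

lemma regular_commute_sub:
  assumes X: "regular X" and Y: "regular Y"
  shows "X O Y \<subseteq> Y O X"
proof clarify
  fix x y z assume xz: "(x, z) \<in> X" and zy: "(z, y) \<in> Y"
  have V: "x \<in> V" "y \<in> V" "z \<in> V"
    using xz zy regular_sub[OF X] regular_sub[OF Y] by auto
  have "(x, y) \<in> S (d x z) (d z x) O S (d z y) (d y z)"
    using V S_memI by blast
  then have "(x, y) \<in> S (d z y) (d y z) O S (d x z) (d z x)"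
    using two_way_commute by blast
  then show "(x, y) \<in> Y O X"
    using regularD[OF X xz] regularD[OF Y zy] by blast
qed

lemma regular_commute: "regular X \<Longrightarrow> regular Y \<Longrightarrow> X O Y = Y O X"
  using regular_commute_sub by blast

lemma regular_left_commute:
  "regular X \<Longrightarrow> regular Y \<Longrightarrow> X O (Y O Z) = Y O (X O Z)"
  by (metis O_assoc regular_commute)

lemma regular_Id_left [simp]: "regular X \<Longrightarrow> Id_on V O X = X"
  using regular_sub by fastforce

lemma regular_Id_right [simp]: "regular X \<Longrightarrow> X O Id_on V = X"
  using regular_sub by fastforce

section \<open>Words of arc types and circuits\<close>

lemma word_append: "word (us @ vs) = word us O word vs"
  by (induction us) (auto simp: O_assoc)

lemma word_perm: "mset ns = mset ms \<Longrightarrow> word ns = word ms"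
proof (induction ns arbitrary: ms)
  case (Cons a ns)
  then have "a \<in> set ms"
    by (metis list.set_intros(1) mset_eq_setD)
  then obtain m1 m2 where ms: "ms = m1 @ a # m2"
    by (meson split_list)
  with Cons have "word ns = word (m1 @ m2)"
    by simp
  then show ?case
    by (simp add: ms word_append regular_left_commute)
qed auto

lemma circ_perm: "mset ns = mset ms \<Longrightarrow> circ ns \<longleftrightarrow> circ ms"
  unfolding circ_def using word_perm by metis

lemma circ_append: "circ (us @ vs) \<longleftrightarrow> (\<exists>x y. (x, y) \<in> word us \<and> (y, x) \<in> word vs)"
  unfolding circ_def word_append by blast

text \<open>The rewriting rule behind all circuit manipulations: \<open>us\<close> is traded for
  \<open>vs\<close>, \<open>ts\<close> stays, and positions do not matter because letters
  commute.\<close>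

lemma circ_replace:
  assumes "circ ns" "word us \<subseteq> word vs" "mset ns = mset us + mset ts" "mset ms = mset vs + mset ts"
  shows "circ ms"
proof -
  have "circ (us @ ts)"
    using assms circ_perm[of ns "us @ ts"] by simp
  then have "circ (vs @ ts)"
    using assms(2) unfolding circ_append by blast
  then show ?thesis
    using assms circ_perm[of ms "vs @ ts"] by simp
qed

text \<open>The diagonal is the single relation \<open>S 0 0\<close>, so a closed walk at one vertex
  yields one at every vertex.\<close>

lemma circ_Id: "circ ns \<Longrightarrow> Id_on V \<subseteq> word ns"
proof -
  assume "circ ns"
  then obtain x where x: "(x, x) \<in> word ns"
    by (auto simp: circ_def)
  then have "x \<in> V"
    using regular_sub[OF regular_word] by blast
  then have "S 0 0 \<subseteq> word ns"
    using regularD[OF regular_word x] d_eq_0_iff[of x x] by simp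
  moreover have "Id_on V \<subseteq> S 0 0"
    by (auto simp: two_way_def d_eq_0_iff)
  ultimately show ?thesis
    by blast
qed

lemma word_length:
  "(x, y) \<in> word ns \<Longrightarrow> d x y \<le> length ns"
proof (induction ns arbitrary: x)
  case Nil
  then show ?case
    by (auto simp: d_eq_0_iff)
next
  case (Cons a ns)
  then obtain z where z: "(x, z) \<in> A a" "(z, y) \<in> word ns"
    by auto
  have "y \<in> V"
    using z(2) regular_sub[OF regular_word] by blast
  then have "d x y \<le> d x z + d z y"
    using S_memD[OF z(1)[unfolded A_def]] triangle by blast
  then show ?case
    using Cons.IH[OF z(2)] S_memD[OF z(1)[unfolded A_def]] by simp
qed

lemma arc_A: "x \<in> V \<Longrightarrow> y \<in> V \<Longrightarrow> d x y = 1 \<Longrightarrow> (x, y) \<in> A (Suc (d y x))"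
  by (simp add: A_def two_way_def)

lemma word_exists:
  "x \<in> V \<Longrightarrow> y \<in> V \<Longrightarrow> \<exists>ns. length ns = d x y \<and> (x, y) \<in> word ns"
proof (induction "d x y" arbitrary: x)
  case 0
  then show ?case
    using d_eq_0_iff by (intro exI[of _ "[]"]) auto
next
  case (Suc n)
  obtain z where z: "z \<in> V" "d x z = 1" "d z y = n"
    using first_step Suc by metis
  then obtain ns where "length ns = n" "(z, y) \<in> word ns"
    using Suc by metis
  then show ?case
    using Suc z arc_A[of x z] by (intro exI[of _ "Suc (d z x) # ns"]) auto
qed

lemma A_memD: "(x, y) \<in> A n \<Longrightarrow> x \<in> V \<and> y \<in> V \<and> d x y = 1 \<and> d y x = n - 1 \<and> 2 \<le> n"
proof -
  assume "(x, y) \<in> A n"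
  then have a: "x \<in> V" "y \<in> V" "d x y = 1" "d y x = n - 1"
    by (auto simp: A_def two_way_def)
  then have "x \<noteq> y"
    using d_eq_0_iff by fastforce
  then have "n - 1 \<noteq> 0"
    using a d_eq_0_iff by metis
  then show ?thesis
    using a by auto
qed

lemma A_unique: "(x, y) \<in> A m \<Longrightarrow> (x, y) \<in> A n \<Longrightarrow> m = n"
  by (auto dest!: A_memD)

text \<open>With the letter \<open>n\<close> brought to the front, the other letters lead from the
  head of that arc back to its tail, which takes at least \<open>n - 1\<close> steps.\<close>

lemma circ_bounds:
  assumes "circ ns" "n \<in> set ns"
  shows "2 \<le> n" "n \<le> length ns"
proof -
  obtain m1 m2 where ns: "ns = m1 @ n # m2"
    using assms(2) by (meson split_list)
  then have "circ ([n] @ (m1 @ m2))"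
    using assms(1) circ_perm[of ns "[n] @ (m1 @ m2)"] by simp
  then obtain x y where "(x, y) \<in> A n" "(y, x) \<in> word (m1 @ m2)"
    unfolding circ_append by auto
  then show "2 \<le> n" "n \<le> length ns"
    using A_memD[of x y n] word_length[of y x "m1 @ m2"] ns by auto
qed

section \<open>Consequences of thickness\<close>

lemma A_thick: "(x, z) \<in> A n \<Longrightarrow> (y, z) \<in> A n \<Longrightarrow> (x, w) \<in> A n \<Longrightarrow> (y, w) \<in> A n"
  unfolding A_def by (rule two_way_thick)

lemma F_converse: "(F n)\<inverse> = F n"
  by (auto simp: F_def)

lemma F_alt: "F n = (A n)\<inverse> O A n"
  unfolding F_def by (rule regular_commute) auto

lemma F_A: "F n O A n \<subseteq> A n"
proof
  fix p assume "p \<in> F n O A n"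
  then obtain x y z w where "p = (x, w)" "(x, z) \<in> A n" "(y, z) \<in> A n" "(y, w) \<in> A n"
    by (auto simp: F_def)
  then show "p \<in> A n"
    using A_thick by blast
qed

lemma A_F: "A n O F n \<subseteq> A n"
  using F_A regular_commute[of "A n" "F n"] by simp

lemma F_F: "F n O F n \<subseteq> F n"
proof -
  have "F n O F n = (F n O A n) O (A n)\<inverse>"
    by (simp add: F_def O_assoc)
  also have "\<dots> \<subseteq> F n"
    using F_A[of n] unfolding F_def by (simp add: relcomp_mono)
  finally show ?thesis .
qed

text \<open>By commutativity \<open>F n\<close> also relates out-neighbours of a common vertex, so
  these share their own out-neighbours of type \<open>n\<close>.\<close>

lemma A_thick2: "(x, z) \<in> A n \<Longrightarrow> (z, y) \<in> A n \<Longrightarrow> (x, w) \<in> A n \<Longrightarrow> (w, y) \<in> A n"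
proof -
  assume "(x, z) \<in> A n" "(z, y) \<in> A n" "(x, w) \<in> A n"
  then have "(w, z) \<in> F n"
    by (auto simp: F_alt)
  then show ?thesis
    using \<open>(z, y) \<in> A n\<close> F_A by blast
qed

text \<open>By \<open>A_thick2\<close> every \<open>A a\<close>-neighbour of \<open>x\<close> has an
  \<open>A a\<close>-arc to \<open>y\<close>, and an arc has only one type.\<close>

lemma A_meet_square:
  assumes "(x, y) \<in> A a O A a" "(x, y) \<in> A a O A b"
  shows "a = b"
proof -
  obtain z w where "(x, z) \<in> A a" "(z, y) \<in> A a" "(x, w) \<in> A a" "(w, y) \<in> A b"
    using assms by auto
  then show ?thesis
    using A_thick2[of x z a y w] A_unique[of w y] by simp
qed

text \<open>Pull the common pair back along the first arc, spread the result over \<open>A b\<close>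
  by regularity, and multiply by \<open>A a\<close> again; the resulting \<open>F a\<close> is
  absorbed.\<close>

lemma A_comp_meet_sub:
  assumes "(x, y) \<in> A a O A b" "(x, y) \<in> A a O A c"
  shows "A a O A b \<subseteq> A a O A c"
proof -
  obtain z where z: "(x, z) \<in> A a" "(z, y) \<in> A b"
    using assms(1) by auto
  have "(z, y) \<in> (A a)\<inverse> O A a O A c"
    using assms(2) z by auto
  then have "A b \<subseteq> (A a)\<inverse> O A a O A c"
    by (rule regular_meet_A[OF _ z(2), rotated]) simp
  then have "A a O A b \<subseteq> A a O (A a)\<inverse> O A a O A c"
    by (simp add: relcomp_mono)
  also have "\<dots> = (F a O A a) O A c"
    by (simp add: F_def O_assoc)
  also have "\<dots> \<subseteq> A a O A c"
    using F_A by (simp add: relcomp_mono)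
  finally show ?thesis .
qed

text \<open>The exchange principle: products meeting the same two-way relation both contain it, and
  sharing one pair suffices for equality.\<close>

lemma A_comp_meet_eq:
  assumes "(x, y) \<in> A a O A b" "(x, y) \<in> S i j" "(x', y') \<in> A a O A c" "(x', y') \<in> S i j"
  shows "A a O A b = A a O A c"
proof -
  have "(x, y) \<in> A a O A c"
    using regular_meet[OF _ assms(4,3)] assms(2) by auto
  then show ?thesis
    using A_comp_meet_sub assms(1) by (meson subset_antisym)
qed

lemma A_irrefl: "(x, x) \<notin> A n"
  using d_eq_0_iff[of x x] by (auto dest!: A_memD)

lemma A_not_in_F: "(x, y) \<in> A n \<Longrightarrow> (x, y) \<notin> F n"
  using A_thick[of x _ n y y] A_irrefl by (auto simp: F_def)

lemma A_not_in_square: "(x, y) \<in> A n \<Longrightarrow> (x, y) \<notin> A n O A n"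
  using A_thick2[of x _ n y y] A_irrefl by auto

text \<open>Telescoping: the converse of \<open>A n\<close> followed by \<open>A n\<close> in the
  middle is \<open>F n\<close>, which the next letter absorbs.\<close>

lemma word_replicate_F: "k > 0 \<Longrightarrow> (word (replicate k n))\<inverse> O word (replicate k n) \<subseteq> F n"
proof (induction k)
  case (Suc k)
  show ?case
  proof (cases "k = 0")
    case True
    then show ?thesis
      by (simp add: F_alt)
  next
    case False
    then obtain j where j: "k = Suc j"
      using not0_implies_Suc by blast
    let ?X = "word (replicate k n)"
    have "F n O ?X \<subseteq> ?X"
      using relcomp_mono[OF F_A[of n] subset_refl] unfolding j by (simp add: O_assoc)
    then have "?X\<inverse> O (F n O ?X) \<subseteq> ?X\<inverse> O ?X"
      by (simp add: relcomp_mono)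
    moreover have "(A n O ?X)\<inverse> O (A n O ?X) = ?X\<inverse> O (F n O ?X)"
      by (simp add: F_alt converse_relcomp O_assoc)
    ultimately show ?thesis
      using Suc.IH False by simp
  qed
qed auto

lemma square_F: "(A n O A n)\<inverse> O A n O A n \<subseteq> F n"
  using word_replicate_F[of 2 n] by (simp add: numeral_2_eq_2)

text \<open>The word contains the diagonal, hence lies in its converse times itself, which is inside
  \<open>F n\<close>. Conversely, appending the closed walk to the converse of \<open>A n\<close>
  leaves a factor \<open>F n\<close> that is absorbed.\<close>

lemma circ_replicate_F:
  assumes "circ (replicate n n)" "n > 0"
  shows "word (replicate n n) = F n"
proof
  let ?X = "word (replicate n n)"
  have Id: "Id_on V \<subseteq> ?X"
    using assms(1) by (rule circ_Id)
  have "?X = (Id_on V)\<inverse> O ?X"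
    by simp
  also have "\<dots> \<subseteq> ?X\<inverse> O ?X"
    using Id by blast
  also have "\<dots> \<subseteq> F n"
    using word_replicate_F assms(2) by blast
  finally show "?X \<subseteq> F n" .
  have "2 \<le> n"
    using circ_bounds[OF assms(1), of n] assms(2) by simp
  then obtain k where k: "n = Suc (Suc k)"
    by (metis Suc_le_D numeral_2_eq_2 Suc_le_mono)
  have X: "?X = A n O A n O word (replicate k n)"
    by (subst k) simp
  have "(A n)\<inverse> = (A n)\<inverse> O Id_on V"
    by simp
  also have "\<dots> \<subseteq> (A n)\<inverse> O A n O A n O word (replicate k n)"
    using Id unfolding X by blast
  also have "\<dots> = (F n O A n) O word (replicate k n)"
    by (simp add: F_alt O_assoc)
  also have "\<dots> \<subseteq> A n O word (replicate k n)"
    using F_A by (simp add: relcomp_mono)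
  finally show "F n \<subseteq> ?X"
    unfolding X F_def by blast
qed

lemma circ_replicate_append:
  assumes "circ (replicate n n)" "n > 0" "(x, y) \<in> word us" "(y, x) \<in> F n"
  shows "circ (us @ replicate n n)"
  using assms circ_replicate_F circ_append by blast

text \<open>The block of \<open>n\<close> letters acts as \<open>F n\<close>, stays inside
  \<open>F m\<close> and is swallowed by the letter \<open>m\<close>; the circuit loses
  \<open>n\<close> arcs.\<close>

lemma circ_absorb:
  assumes "circ (replicate n n)" "n > 0" "F n \<subseteq> F m"
    "circ ns" "mset ns = mset (m # ms) + replicate_mset n n"
  shows "circ (m # ms)"
proof (rule circ_replace[OF assms(4), of "m # replicate n n" "[m]" ms])
  have "A m O word (replicate n n) \<subseteq> A m O F m"
    using circ_replicate_F[OF assms(1,2)] assms(3) by (simp add: relcomp_mono)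
  then show "word (m # replicate n n) \<subseteq> word [m]"
    using A_F[of m] by simp
qed (use assms(5) in auto)

text \<open>A shortest path back closes an arc of type \<open>n\<close> to a circuit of length
  \<open>n\<close>, whose letters purity then fixes.\<close>

lemma pure_circ:
  assumes "pure n" "A n \<noteq> {}"
  shows "circ (replicate n n)"
proof -
  obtain x y where xy: "(x, y) \<in> A n"
    using assms(2) by auto
  then obtain ns where ns: "length ns = d y x" "(y, x) \<in> word ns"
    using word_exists A_memD by metis
  have len: "length (n # ns) = n"
    using A_memD[OF xy] ns by simp
  have "circ (n # ns)"
    using xy ns circ_append[of "[n]" ns] by auto
  then have "set (n # ns) = {n}"
    using assms(1) len unfolding pure_def by (metis list.set_intros(1))
  then have "n # ns = replicate n n"
    using replicate_eqI[of "n # ns" n n] len by blast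
  then show ?thesis
    using \<open>circ (n # ns)\<close> by simp
qed

section \<open>Ends of two consecutive arcs of a circuit\<close>

lemma back_dist_ge:
  assumes "(x, z) \<in> A a O A b"
  shows "a \<le> d z x + 2" "b \<le> d z x + 2" "d x z \<le> 2"
proof -
  obtain y where y: "(x, y) \<in> A a" "(y, z) \<in> A b"
    using assms by auto
  note m = A_memD[OF y(1)] A_memD[OF y(2)]
  show "a \<le> d z x + 2" "b \<le> d z x + 2" "d x z \<le> 2"
    using m triangle[of y z x] triangle[of z x y] triangle[of x y z] by auto
qed

lemma circ_pair:
  assumes "circ ns" "mset ns = {#a, b#} + mset ms"
  obtains x z where "(x, z) \<in> A a O A b" "(z, x) \<in> word ms" "d z x \<le> length ms"
    "x \<in> V" "z \<in> V"
proof -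
  have "circ ([a, b] @ ms)"
    using assms circ_perm[of ns "[a, b] @ ms"] by simp
  then obtain x z where xz: "(x, z) \<in> word [a, b]" "(z, x) \<in> word ms"
    unfolding circ_append by blast
  then show ?thesis
    using that[of x z] word_length[of z x ms] regular_sub[OF regular_word[of ms]] by auto
qed

text \<open>A shorter walk from \<open>x\<close> to \<open>z\<close> would give a circuit of fewer
  than \<open>q\<close> arcs that still contains the letter \<open>q\<close> of
  \<open>ms\<close>.\<close>

lemma circ_pair_fwd:
  assumes "(z, x) \<in> word ms" "q \<in> set ms" "q = length ms + 2" "(x, z) \<in> A a O A b"
  shows "d x z = 2"
proof -
  have "x \<in> V" "z \<in> V"
    using assms(1) regular_sub[OF regular_word[of ms]] by auto
  then obtain js where "length js = d x z" "(x, z) \<in> word js"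
    using word_exists by blast
  then have "q \<le> d x z + length ms"
    using circ_append[of js ms] circ_bounds(2)[of "js @ ms" q] assms(1,2) by auto
  then show ?thesis
    using assms(3) back_dist_ge(3)[OF assms(4)] by simp
qed

lemma two_step_dist_nonzero:
  assumes "(x, z) \<in> A a O A b" "a \<noteq> 2"
  shows "d x z \<noteq> 0"
proof
  assume "d x z = 0"
  moreover have "x \<in> V" "z \<in> V"
    using assms(1) by (auto dest: A_memD)
  ultimately have "x = z"
    using d_eq_0_iff by blast
  then have "circ [a, b]"
    using assms(1) by (auto simp: circ_def)
  then show False
    using circ_bounds[of "[a, b]" a] assms(2) by simp
qed

text \<open>A circuit of length \<open>q\<close> through an arc of type \<open>q\<close> cannot be shortened without losing all
  arcs of type \<open>q\<close>; this pins down the two-way distance of the ends of any two consecutive arcs.\<close>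

lemma double_pair:
  assumes "circ ns" "length ns = q" "mset ns = {#q, q, r#} + mset ms" "r \<noteq> q"
  shows "\<exists>x z. (x, z) \<in> A q O A r \<and> (x, z) \<in> S 2 (q - 2)"
    and "S 2 (q - 2) \<inter> A q O A q = {}"
proof -
  have len: "q = length ms + 3"
    using arg_cong[OF assms(3), of size] assms(2) by simp
  obtain x z where xz: "(x, z) \<in> A q O A r" "(z, x) \<in> word (q # ms)" "d z x \<le> length (q # ms)"
    "x \<in> V" "z \<in> V"
    by (rule circ_pair[OF assms(1), of q r "q # ms"]) (use assms(3) in auto)
  have "d x z = 2"
    by (rule circ_pair_fwd[OF xz(2) _ _ xz(1), of q]) (use len in auto)
  moreover have "d z x = q - 2"
    using back_dist_ge(1)[OF xz(1)] xz(3) len by simp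
  ultimately have S: "(x, z) \<in> S 2 (q - 2)"
    using S_memI[OF xz(4,5)] by simp
  then show "\<exists>x z. (x, z) \<in> A q O A r \<and> (x, z) \<in> S 2 (q - 2)"
    using xz(1) by blast
  \<comment> \<open>A pair of \<open>A q O A q\<close> in this relation would lie in
    \<open>A q O A r\<close> as well, forcing \<open>r = q\<close>.\<close>
  have sub: "S 2 (q - 2) \<subseteq> A q O A r"
    using regular_meet[OF _ S xz(1)] by simp
  then show "S 2 (q - 2) \<inter> A q O A q = {}"
    using A_meet_square[of _ _ q r] assms(4) by blast
qed

text \<open>Forward distances 2 and 0 are excluded for the ends of the two arcs of type
  \<open>q\<close>, so an arc of type \<open>q - 1\<close> remains. This is C(\<open>q\<close>) up
  to purity of \<open>q - 1\<close>.\<close>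

lemma double_square:
  assumes "circ ns" "length ns = q" "mset ns = {#q, q, r#} + mset ms" "r \<noteq> q"
  shows "A (q - 1) \<subseteq> A q O A q" "A (q - 1) \<noteq> {}"
proof -
  have len: "q = length ms + 3"
    using arg_cong[OF assms(3), of size] assms(2) by simp
  obtain x z where xz: "(x, z) \<in> A q O A q" "(z, x) \<in> word (r # ms)" "d z x \<le> length (r # ms)"
    "x \<in> V" "z \<in> V"
    by (rule circ_pair[OF assms(1), of q q "r # ms"]) (use assms(3) in auto)
  have zx: "d z x = q - 2"
    using back_dist_ge(1)[OF xz(1)] xz(3) len by simp
  have "d x z \<noteq> 2"
    using double_pair(2)[OF assms] S_memI[OF xz(4,5)] zx xz(1) by auto
  moreover have "d x z \<noteq> 0"
    using two_step_dist_nonzero[OF xz(1)] len by simp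
  ultimately have "d x z = 1"
    using back_dist_ge(3)[OF xz(1)] by simp
  then have "(x, z) \<in> A (q - 1)"
    using arc_A[OF xz(4,5)] zx len by simp
  then show "A (q - 1) \<subseteq> A q O A q" "A (q - 1) \<noteq> {}"
    using regular_meet_A[OF _ _ xz(1)] by auto
qed

text \<open>The two circuits may differ: both products meet the one relation
  \<open>S 2 (q - 2)\<close>.\<close>

lemma double_exchange:
  assumes "circ ns" "length ns = q" "mset ns = {#q, q, r#} + mset ms" "r \<noteq> q"
    and "circ ns'" "length ns' = q" "mset ns' = {#q, q, s#} + mset ms'" "s \<noteq> q"
  shows "A q O A r = A q O A s"
  using double_pair(1)[OF assms(1-4)] double_pair(1)[OF assms(5-8)] A_comp_meet_eq by blast

section \<open>Shortening words by means of C and D\<close>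

text \<open>Ends of two \<open>A r O A r\<close> walks from one vertex are
  \<open>F r\<close>-equivalent, and one of these ends may be reached by an arc of
  \<open>A p\<close>. In use \<open>p = r - 1\<close>, so the last inclusion trades three letters
  \<open>r\<close> for two letters.\<close>

lemma conf_C_cube:
  assumes "A p \<subseteq> A r O A r" "A p \<noteq> {}"
  shows "A r O A r \<subseteq> A p O F r" "F p \<subseteq> F r" "A r O A r O A r \<subseteq> A p O A r"
proof -
  show sq: "A r O A r \<subseteq> A p O F r"
  proof
    fix e assume e: "e \<in> A r O A r"
    obtain x z where xz: "e = (x, z)"
      by fastforce
    obtain u v where uv: "(u, v) \<in> A p"
      using assms(2) by auto
    \<comment> \<open>An arc of \<open>A p\<close> starts at \<open>u\<close>; the diagonal being a
      single relation, one starts at \<open>x\<close> too.\<close>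
    have "(u, u) \<in> A p O (A p)\<inverse>"
      using uv by auto
    moreover have "x \<in> V" "u \<in> V"
      using e xz uv by (auto dest: A_memD)
    ultimately have "(x, x) \<in> A p O (A p)\<inverse>"
      using regularD[of "A p O (A p)\<inverse>" u u] S_memI[of x x] d_eq_0_iff[of x x] d_eq_0_iff[of u u]
      by auto
    then obtain w where w: "(x, w) \<in> A p"
      by auto
    then have "(w, z) \<in> (A r O A r)\<inverse> O A r O A r"
      using assms(1) e xz by blast
    then show "e \<in> A p O F r"
      using square_F w xz by blast
  qed
  have "F p = (A p)\<inverse> O A p"
    by (rule F_alt)
  also have "\<dots> \<subseteq> (A r O A r)\<inverse> O (A r O A r)"
    by (rule relcomp_mono) (use assms(1) in auto)
  also have "\<dots> \<subseteq> F r"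
    by (rule square_F)
  finally show "F p \<subseteq> F r" .
  have "A r O A r O A r = (A r O A r) O A r"
    by (simp add: O_assoc)
  also have "\<dots> \<subseteq> (A p O F r) O A r"
    using sq by (simp add: relcomp_mono)
  also have "\<dots> = A p O (F r O A r)"
    by (simp add: O_assoc)
  also have "\<dots> \<subseteq> A p O A r"
    using F_A by (simp add: relcomp_mono)
  finally show "A r O A r O A r \<subseteq> A p O A r" .
qed

lemma conf_D_absorb: "A r \<subseteq> F p \<Longrightarrow> A r O A p \<subseteq> A p"
  using F_A by blast

lemma circ_A_nonempty: "circ ns \<Longrightarrow> n \<in> set ns \<Longrightarrow> A n \<noteq> {}"
proof -
  assume c: "circ ns" and n: "n \<in> set ns"
  obtain m1 m2 where "ns = m1 @ n # m2"
    using n by (meson split_list)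
  then show ?thesis
    using c by (auto simp: circ_def word_append)
qed

lemma conf_cases:
  assumes "conf_C p \<or> conf_D p"
  obtains k where "p = Suc (Suc (Suc k))" "A (p - 1) \<noteq> {}" "circ (replicate (p - 1) (p - 1))"
proof -
  have ne: "A (p - 1) \<noteq> {}" and pu: "pure (p - 1)"
    using assms by (auto simp: conf_C_def conf_D_def F_def)
  then have "2 \<le> p - 1"
    using A_memD by fastforce
  then have "p = Suc (Suc (Suc (p - 3)))"
    by simp
  then show ?thesis
    using that[of "p - 3"] ne pure_circ[OF pu ne] by blast
qed

text \<open>A common pair would be joined by a walk of types \<open>q, m\<close> and closed by
  \<open>m\<close> arcs of type \<open>m\<close>. Absorbing these leaves the circuit
  \<open>m, q\<close>, too short for \<open>q > 2\<close>.\<close>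

lemma F_disjoint:
  assumes "circ (replicate m m)" "m > 0" "q > 2" "(x, z) \<in> A q O A m" "(x, z) \<in> S i j"
  shows "S i j \<inter> F m = {}"
proof (rule ccontr)
  assume "S i j \<inter> F m \<noteq> {}"
  then obtain u v where uv: "(u, v) \<in> S i j" "(u, v) \<in> F m"
    by auto
  then have "(u, v) \<in> A q O A m"
    using regular_meet[OF _ assms(5,4)] by auto
  moreover have "(v, u) \<in> F m"
    using uv(2) F_converse by blast
  ultimately have "circ ([q, m] @ replicate m m)"
    using circ_replicate_append[OF assms(1,2), of u v "[q, m]"] by simp
  then have "circ [m, q]"
    using circ_absorb[OF assms(1,2), of m _ "[q]"] by auto
  then show False
    using circ_bounds(2)[of "[m, q]" q] assms(3) by simp
qed

text \<open>The ends of two consecutive arcs of type \<open>p\<close> lie in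
  \<open>F (p - 1)\<close>, which squeezes their two-way distance to \<open>(2, p - 2)\<close>. In
  the resulting circuit of length \<open>p\<close>, a letter other than \<open>p\<close> would put
  \<open>A (p - 1)\<close> into \<open>F (p - 1)\<close>.\<close>

lemma conf_D_circ:
  assumes D: "conf_D p" and disj: "S 2 (p - 1) \<inter> F (p - 1) = {}"
  shows "circ (replicate p p)"
proof -
  obtain k where k: "p = Suc (Suc (Suc k))"
    using conf_cases D by metis
  have sub: "A p \<subseteq> F (p - 1)" and ne: "A p \<noteq> {}"
    using D by (auto simp: conf_D_def)
  have sq: "A p O A p \<subseteq> F (p - 1)"
    using relcomp_mono[OF sub sub] F_F by blast
  have "A p O A p \<noteq> {}"
  proof -
    obtain x y where "(x, y) \<in> A p"
      using ne by auto
    then have "(y, y) \<in> (A p)\<inverse> O A p"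
      by auto
    \<comment> \<open>Commutativity supplies an arc of type \<open>p\<close> leaving the head
      \<open>y\<close>.\<close>
    then have "(y, y) \<in> A p O (A p)\<inverse>"
      using regular_commute[of "A p" "(A p)\<inverse>"] by simp
    then show ?thesis
      using \<open>(x, y) \<in> A p\<close> by auto
  qed
  then obtain x z where xz: "(x, z) \<in> A p O A p"
    by auto
  have V: "x \<in> V" "z \<in> V"
    using xz by (auto dest: A_memD)
  have "(x, z) \<in> F (p - 1)"
    using xz sq by blast
  \<comment> \<open>The return from \<open>z\<close> to \<open>x\<close> can use one arc to
    \<open>u\<close> and then \<open>p - 2\<close> steps.\<close>
  then obtain u where u: "(x, u) \<in> A (p - 1)" "(z, u) \<in> A (p - 1)"
    by (auto simp: F_def)
  have zx: "d z x \<le> p - 1" "p \<le> d z x + 2"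
    using A_memD[OF u(1)] A_memD[OF u(2)] triangle[of z u x] back_dist_ge(1)[OF xz] k by auto
  have "d x z \<noteq> 0"
    using two_step_dist_nonzero[OF xz] k by simp
  moreover have "d x z \<noteq> 1"
  proof
    assume "d x z = 1"
    then have arc: "(x, z) \<in> A (Suc (d z x))"
      using arc_A V by blast
    \<comment> \<open>Type \<open>p\<close> contradicts \<open>A_not_in_square\<close>, type
      \<open>p - 1\<close> contradicts \<open>A_not_in_F\<close>.\<close>
    have "Suc (d z x) = p \<or> Suc (d z x) = p - 1"
      using zx k by auto
    then show False
      using arc xz sq A_not_in_F A_not_in_square by (metis subsetD)
  qed
  ultimately have "d x z = 2"
    using back_dist_ge(3)[OF xz] by simp
  then have "d z x \<noteq> p - 1"
    using S_memI[OF V] disj \<open>(x, z) \<in> F (p - 1)\<close> by auto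
  then have zx2: "d z x = p - 2"
    using zx by simp
  obtain js where js: "length js = d z x" "(z, x) \<in> word js"
    using word_exists V by blast
  then have c: "circ (p # p # js)"
    using circ_append[of "[p, p]" js] xz by auto
  have "r = p" if r: "r \<in> set js" for r
  proof (rule ccontr)
    assume "r \<noteq> p"
    obtain j1 j2 where "js = j1 @ r # j2"
      using r by (meson split_list)
    then have "A (p - 1) \<subseteq> A p O A p" "A (p - 1) \<noteq> {}"
      using double_square[OF c, of p r "j1 @ j2"] js zx2 k \<open>r \<noteq> p\<close> by auto
    then show False
      using sq A_not_in_F by blast
  qed
  then have "p # p # js = replicate p p"
    using js zx2 k by (intro replicate_eqI) auto
  then show ?thesis
    using c by simp
qed

section \<open>Circuits with at least two arcs of type q\<close>

text \<open>After \<open>double_square\<close> only purity of \<open>p = q - 1\<close> is missing.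
  If \<open>p\<close> is mixed, C(\<open>p\<close>) or D(\<open>p\<close>) yields circuits of length
  \<open>q\<close> with two letters \<open>q\<close> in which \<open>p\<close> and
  \<open>m = q - 2\<close> occur. These letters are then interchangeable next to \<open>q\<close>,
  and an exchange permits a shortening.\<close>

lemma double_conf_C:
  assumes c0: "circ ns" "length ns = q" "mset ns = {#q, q, r#} + mset ms" "r \<noteq> q"
    and IH: "\<And>n. n < q \<Longrightarrow> \<not> pure n \<Longrightarrow> conf_C n \<or> conf_D n"
  shows "conf_C q"
proof (rule ccontr)
  assume nC: "\<not> conf_C q"
  define p where "p = q - 1"
  note sq = double_square[OF c0, folded p_def]
  have "\<not> pure p"
    using nC sq by (auto simp: conf_C_def p_def)
  moreover have "q \<ge> 3"
    using arg_cong[OF c0(3), of size] c0(2) by simp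
  ultimately have CD: "conf_C p \<or> conf_D p"
    using IH[of p] by (simp add: p_def)
  define m where "m = p - 1"
  obtain k where k: "p = Suc (Suc (Suc k))" and mne: "A m \<noteq> {}" and cm: "circ (replicate m m)"
    using conf_cases[OF CD, folded m_def] by metis
  have mk: "m = Suc (Suc k)" and qk: "q = Suc (Suc (Suc (Suc k)))"
    using k \<open>q \<ge> 3\<close> by (auto simp: m_def p_def)
  have rm: "replicate m m = m # m # replicate k m"
    by (simp add: mk)
  have neq: "p \<noteq> q" "m \<noteq> q"
    using k mk qk by auto
  from CD show False
  proof
    assume D: "conf_D p"
    then have sub: "A p \<subseteq> F m"
      by (simp add: conf_D_def m_def)
    obtain x y where xy: "(x, y) \<in> A p"
      using sq(2) by auto
    then have "(x, y) \<in> word [q, q]" "(y, x) \<in> F m"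
      using sq(1) sub F_converse[of m] by auto
    \<comment> \<open>A pair of \<open>A p\<close> is spanned by two arcs of type \<open>q\<close>
      and closed through \<open>F m\<close>; the total length is \<open>m + 2 = q\<close>.\<close>
    then have c1: "circ ([q, q] @ replicate m m)"
      using circ_replicate_append[OF cm, of x y "[q, q]"] mk by blast
    have "\<exists>x z. (x, z) \<in> A q O A m \<and> (x, z) \<in> S 2 (q - 2)"
      by (rule double_pair(1)[OF c1, of q m "m # replicate k m"]) (use neq in \<open>simp_all add: mk qk\<close>)
    then have "S 2 (q - 2) \<inter> F m = {}"
      using F_disjoint[OF cm, of q] mk qk by (metis Suc_less_eq numeral_2_eq_2 zero_less_Suc)
    then have cp: "circ (replicate p p)"
      using conf_D_circ[OF D] by (simp add: k m_def[symmetric] mk qk)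
    have c2: "circ (q # q # replicate m p)"
      by (rule circ_replace[OF cp, of "[p]" "[q, q]" "replicate m p"])
        (use sq in \<open>simp_all add: mk k\<close>)
    have ex: "A q O A m = A q O A p"
      by (rule double_exchange[OF c1 _ _ neq(2) c2 _ _ neq(1),
            of "m # replicate k m" "p # replicate k p"]) (simp_all add: mk qk)
    have c3: "circ (q # q # p # m # replicate k m)"
      by (rule circ_replace[OF c1, of "[q, m]" "[q, p]" "q # m # replicate k m"])
        (use ex in \<open>simp_all add: rm\<close>)
    \<comment> \<open>The letter \<open>p\<close> vanishes next to \<open>m\<close>, leaving only
      \<open>q - 1\<close> arcs.\<close>
    have c4: "circ (q # q # m # replicate k m)"
      by (rule circ_replace[OF c3, of "[p, m]" "[m]" "q # q # replicate k m"])
        (use conf_D_absorb[OF sub] in simp_all)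
    show False
      using circ_bounds(2)[OF c4, of q] qk by simp
  next
    assume C: "conf_C p"
    then have sub: "A m \<subseteq> A p O A p"
      by (simp add: conf_C_def m_def)
    have c1: "circ (p # p # m # replicate k m)"
      by (rule circ_replace[OF cm, of "[m]" "[p, p]" "m # replicate k m"])
        (use sub in \<open>simp_all add: rm\<close>)
    have c2: "circ (q # q # p # m # replicate k m)"
      by (rule circ_replace[OF c1, of "[p]" "[q, q]" "p # m # replicate k m"])
        (use sq in simp_all)
    have ex: "A q O A m = A q O A p"
      by (rule double_exchange[OF c2 _ _ neq(2) c2 _ _ neq(1),
            of "p # replicate k m" "m # replicate k m"]) (simp_all add: qk)
    have c3: "circ (q # q # p # p # replicate k m)"
      by (rule circ_replace[OF c2, of "[q, m]" "[q, p]" "q # p # replicate k m"])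
        (use ex in simp_all)
    \<comment> \<open>The letters \<open>p, p\<close> become \<open>m\<close> up to
      \<open>F p\<close>, which lies in \<open>F q\<close> and disappears next to
      \<open>q\<close>.\<close>
    have "A q O A p O A p \<subseteq> A q O A m O F q"
    proof -
      have "A p O A p \<subseteq> A m O F p"
        using conf_C_cube(1)[OF sub mne] .
      also have "\<dots> \<subseteq> A m O F q"
        using conf_C_cube(2)[OF sq] by (simp add: relcomp_mono)
      finally show ?thesis
        by (simp add: relcomp_mono)
    qed
    also have "\<dots> = A m O A q O F q"
      by (simp add: regular_left_commute)
    also have "\<dots> \<subseteq> A m O A q"
      using A_F by (simp add: relcomp_mono)
    finally have ab: "A q O A p O A p \<subseteq> A m O A q" .
    have c4: "circ (q # m # q # replicate k m)"
      by (rule circ_replace[OF c3, of "[q, p, p]" "[m, q]" "q # replicate k m"])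
        (use ab in simp_all)
    show False
      using circ_bounds(2)[OF c4, of q] qk by simp
  qed
qed

section \<open>Circuits with one arc of type q and a single other type\<close>

lemma word_replicate_sub_F:
  assumes "A r \<subseteq> F p" "k > 0"
  shows "word (replicate k r) \<subseteq> F p"
  using assms(2)
proof (induction k)
  case (Suc k)
  show ?case
  proof (cases "k = 0")
    case False
    then show ?thesis
      using relcomp_mono[OF assms(1) Suc.IH] F_F[of p] by auto
  qed (use assms(1) in simp)
qed auto

text \<open>For pure \<open>r\<close>, exactly \<open>r\<close> further letters close the arc
  through \<open>F r\<close>, which is D(\<open>q\<close>), while more than \<open>r\<close> can be
  shortened by absorption. For mixed \<open>r\<close>, C(\<open>r\<close>) shortens three letters
  and D(\<open>r\<close>) places the return path in \<open>F (r - 1)\<close>, making the return too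
  short.\<close>

lemma uniform_conf_D:
  assumes c: "circ (q # replicate (q - 1) r)" and "r \<noteq> q"
    and IH: "\<And>n. n < q \<Longrightarrow> \<not> pure n \<Longrightarrow> conf_C n \<or> conf_D n"
  shows "conf_D q"
proof -
  have q2: "2 \<le> q"
    using circ_bounds(1)[OF c, of q] by simp
  then have rset: "r \<in> set (q # replicate (q - 1) r)"
    by simp
  have r: "2 \<le> r" "r < q"
    using circ_bounds[OF c rset] \<open>r \<noteq> q\<close> q2 by auto
  have min: "q \<le> length ns" if "circ ns" "q \<in> set ns" for ns
    using circ_bounds(2) that .
  obtain x y where xy: "(x, y) \<in> A q" "(y, x) \<in> word (replicate (q - 1) r)"
    using c circ_append[of "[q]" "replicate (q - 1) r"] by auto
  show ?thesis
  proof (cases "pure r")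
    case True
    then have cr: "circ (replicate r r)"
      using pure_circ circ_A_nonempty[OF c rset] by blast
    show ?thesis
    proof (cases "r = q - 1")
      case True
      then have "(y, x) \<in> F r"
        using circ_replicate_F[OF cr] xy(2) r by simp
      then have "(x, y) \<in> F r"
        using F_converse by blast
      then have "A q \<subseteq> F r"
        using regular_meet_A[OF _ xy(1)] by simp
      then show ?thesis
        using xy(1) \<open>pure r\<close> True by (auto simp: conf_D_def)
    next
      case False
      \<comment> \<open>At least \<open>r + 1\<close> letters \<open>r\<close> are present: a block
        of \<open>r\<close> and one more to absorb it.\<close>
      then have "replicate_mset (q - 1) r = replicate_mset (Suc (r + (q - 2 - r))) r"
        using r by (intro arg_cong2[of _ _ _ _ replicate_mset]) auto
      also have "\<dots> = add_mset r (replicate_mset r r + replicate_mset (q - 2 - r) r)"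
        by (simp add: repeat_mset_distrib2 multiset_eq_iff)
      finally have "circ (r # q # replicate (q - 2 - r) r)"
        using circ_absorb[OF cr _ subset_refl c, of "q # replicate (q - 2 - r) r"] r by auto
      then show ?thesis
        using min[of "r # q # replicate (q - 2 - r) r"] r False by simp
    qed
  next
    case False
    then have CD: "conf_C r \<or> conf_D r"
      using IH r by blast
    obtain k where k: "r = Suc (Suc (Suc k))" and ne: "A (r - 1) \<noteq> {}"
      using conf_cases[OF CD] by metis
    from CD show ?thesis
    proof
      assume "conf_C r"
      then have "A r O A r O A r \<subseteq> A (r - 1) O A r"
        using conf_C_cube(3)[OF _ ne] by (auto simp: conf_C_def)
      moreover have "q - 1 = Suc (Suc (Suc (q - 4)))"
        using k r by simp
      ultimately have "circ ((r - 1) # r # q # replicate (q - 4) r)"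
        by (intro circ_replace[OF c, of "[r, r, r]" "[r - 1, r]" "q # replicate (q - 4) r"]) auto
      then show ?thesis
        using min[of "(r - 1) # r # q # replicate (q - 4) r"] r k by simp
    next
      assume "conf_D r"
      then have "(y, x) \<in> F (r - 1)"
        using word_replicate_sub_F[of r "r - 1" "q - 1"] xy(2) q2 by (auto simp: conf_D_def)
      then obtain u where u: "(y, u) \<in> A (r - 1)" "(x, u) \<in> A (r - 1)"
        by (auto simp: F_def)
      then have "d y x \<le> r - 1"
        using A_memD[OF u(1)] A_memD[OF u(2)] triangle[of y u x] by auto
      then show ?thesis
        using A_memD[OF xy(1)] r by simp
    qed
  qed
qed

text \<open>The product is closed by a word of length \<open>p - 1\<close>, which bounds the return
  distance. Two-way distance \<open>(2, p - 2)\<close> would give a circuit of \<open>p\<close> arcs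
  of type \<open>p\<close>, which C(\<open>p\<close>) shortens.\<close>

lemma conf_C_square:
  assumes C: "conf_C p"
  shows "A p O A p \<subseteq> A (p - 1) \<union> S 2 (p - 1)"
proof
  fix e assume e: "e \<in> A p O A p"
  define m where "m = p - 1"
  obtain k where k: "p = Suc (Suc (Suc k))" and mne: "A m \<noteq> {}" and cm: "circ (replicate m m)"
    using conf_cases C unfolding m_def by metis
  have mk: "m = Suc (Suc k)"
    by (simp add: m_def k)
  have rm: "replicate m m = m # m # replicate k m"
    by (simp add: mk)
  have sub: "A m \<subseteq> A p O A p"
    using C by (simp add: conf_C_def m_def)
  obtain x z where xz: "e = (x, z)"
    by fastforce
  have V: "x \<in> V" "z \<in> V"
    using e xz by (auto dest: A_memD)
  have c1: "circ (p # p # m # replicate k m)"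
    by (rule circ_replace[OF cm, of "[m]" "[p, p]" "m # replicate k m"])
      (use sub in \<open>simp_all add: rm\<close>)
  \<comment> \<open>Insert the closed walk \<open>c1\<close> after the converse of
    \<open>?B\<close>: that converse and \<open>?B\<close> merge into \<open>F p\<close>, and
    \<open>m\<close> expands to \<open>p, p\<close>, which absorb \<open>F p\<close>.\<close>
  have "(z, x) \<in> word (p # p # replicate k m)"
  proof -
    let ?B = "A p O A p" and ?X = "word (replicate k m)"
    have "(z, x) \<in> ?B\<inverse> O Id_on V"
      using e xz V by auto
    also have "\<dots> \<subseteq> ?B\<inverse> O (?B O (A m O ?X))"
      using circ_Id[OF c1] by (intro relcomp_mono) (auto simp: O_assoc)
    also have "\<dots> = (?B\<inverse> O ?B) O (A m O ?X)"
      by (simp add: O_assoc)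
    also have "\<dots> \<subseteq> F p O (?B O ?X)"
      using square_F[of p] sub by (intro relcomp_mono) (auto simp: O_assoc)
    also have "\<dots> = (F p O A p) O A p O ?X"
      by (simp add: O_assoc)
    also have "\<dots> \<subseteq> A p O A p O ?X"
      using F_A by (simp add: relcomp_mono)
    finally show ?thesis
      by simp
  qed
  then have le: "d z x \<le> p - 1"
    using word_length k by fastforce
  have e': "(x, z) \<in> A p O A p"
    using e xz by simp
  have ge: "p \<le> d z x + 2"
    using back_dist_ge(1)[OF e'] .
  have nz: "d x z \<noteq> 0"
    using two_step_dist_nonzero[OF e'] k by simp
  consider "d x z = 1" | "d x z = 2"
    using nz back_dist_ge(3)[OF e'] by linarith
  then have "(x, z) \<in> A m \<union> S 2 m"
  proof cases
    case 1
    then have arc: "(x, z) \<in> A (Suc (d z x))"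
      using arc_A V by blast
    then have "Suc (d z x) \<noteq> p"
      using A_not_in_square e' by metis
    then have "Suc (d z x) = m"
      using le ge k mk by simp
    then show ?thesis
      using arc by simp
  next
    case 2
    have "d z x \<noteq> p - 2"
    proof
      assume zx2: "d z x = p - 2"
      obtain js where js: "length js = d z x" "(z, x) \<in> word js"
        using word_exists V by blast
      then have c: "circ (p # p # js)"
        using circ_append[of "[p, p]" js] e' by auto
      have "r = p" if r: "r \<in> set js" for r
      proof (rule ccontr)
        assume "r \<noteq> p"
        obtain j1 j2 where "js = j1 @ r # j2"
          using r by (meson split_list)
        then have "S 2 (p - 2) \<inter> A p O A p = {}"
          using double_pair(2)[OF c, of p r "j1 @ j2"] js zx2 k \<open>r \<noteq> p\<close> by auto
        then show False
          using e' S_memI[OF V] 2 zx2 by (metis IntI emptyE)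
      qed
      then have "js = replicate (Suc k) p"
        using js zx2 k by (intro replicate_eqI) auto
      then have "circ (m # p # replicate k p)"
        using conf_C_cube(3)[OF sub mne]
        by (intro circ_replace[OF c, of "[p, p, p]" "[m, p]" "replicate k p"]) simp_all
      then show False
        using circ_bounds(2)[of "m # p # replicate k p" p] k by simp
    qed
    then have "d z x = m"
      using le ge by (simp add: m_def)
    then show ?thesis
      using S_memI[OF V] 2 by simp
  qed
  then show "e \<in> A (p - 1) \<union> S 2 (p - 1)"
    by (simp add: xz m_def)
qed

section \<open>Letter classes in circuits with exactly one arc of type q\<close>

lemma word_letters_eq:
  assumes "\<And>s. s \<in> set v \<Longrightarrow> A q O A s = A q O A r"
  shows "word (q # v) = word (q # replicate (length v) r)"
  using assms
proof (induction v)
  case (Cons s v)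
  have "word (q # s # v) = A s O word (q # v)"
    by (simp add: regular_left_commute)
  also have "\<dots> = A s O word (q # replicate (length v) r)"
    using Cons by simp
  also have "\<dots> = (A q O A s) O word (replicate (length v) r)"
    by (simp add: regular_left_commute O_assoc)
  also have "\<dots> = (A q O A r) O word (replicate (length v) r)"
    using Cons.prems[of s] by simp
  finally show ?case
    by (simp add: O_assoc)
qed simp

text \<open>In a circuit of length \<open>q\<close> with exactly one arc of type \<open>q\<close>, a further letter \<open>r\<close> is
  classified by the two-way distance \<open>(i, q - 2)\<close>, \<open>i \<in> {1, 2}\<close>, of the ends of a walk of types
  \<open>q, r\<close>; letters of the same class are interchangeable.\<close>

definition letter_class :: "nat \<Rightarrow> nat \<Rightarrow> nat \<Rightarrow> bool" where
  "letter_class q i r \<longleftrightarrow> (\<exists>x z. (x, z) \<in> A q O A r \<and> (x, z) \<in> S i (q - 2))"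

lemma letter_class_eq:
  "letter_class q i r \<Longrightarrow> letter_class q i s \<Longrightarrow> A q O A r = A q O A s"
  unfolding letter_class_def using A_comp_meet_eq by blast

lemma letter_class_cong:
  "A q O A r = A q O A s \<Longrightarrow> letter_class q i r \<longleftrightarrow> letter_class q i s"
  unfolding letter_class_def by simp

lemma letter_class_sub:
  "letter_class q i r \<Longrightarrow> S i (q - 2) \<subseteq> A q O A r \<and> S i (q - 2) \<noteq> {}"
  unfolding letter_class_def using regular_meet[of "A q O A r"] regular_comp[OF regular_A regular_A]
  by blast

lemma letter_class_cases:
  assumes "circ ns" "length ns = q" "mset ns = {#q, r#} + mset ms" "r \<noteq> q"
  shows "letter_class q 1 r \<or> letter_class q 2 r"
proof -
  have len: "q = length ms + 2"
    using arg_cong[OF assms(3), of size] assms(2) by simp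
  have "r \<in># mset ns"
    using assms(3) by simp
  then have "q > 2"
    using circ_bounds[OF assms(1), of r] assms(2,4) by simp
  obtain x z where xz: "(x, z) \<in> A q O A r" "(z, x) \<in> word ms" "d z x \<le> length ms"
    "x \<in> V" "z \<in> V"
    using circ_pair[OF assms(1,3)] by blast
  have "d z x = q - 2"
    using back_dist_ge(1)[OF xz(1)] xz(3) len by simp
  moreover have "d x z = 1 \<or> d x z = 2"
    using two_step_dist_nonzero[OF xz(1)] \<open>q > 2\<close> back_dist_ge(3)[OF xz(1)] by linarith
  ultimately show ?thesis
    unfolding letter_class_def using xz(1) S_memI[OF xz(4,5)] by metis
qed

text \<open>Since \<open>r\<close> is not in class 2, the walk \<open>q, r\<close> shortcuts to an
  arc of type \<open>p = q - 1\<close>, and purity makes all other letters equal to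
  \<open>p\<close>. The ends of \<open>p, r\<close> then admit two return distances: one exchanges
  \<open>r\<close> for a second \<open>q\<close>, the other forces \<open>r = p\<close>.\<close>

lemma letter_class_excl_pure:
  assumes c: "circ (q # r # s # ms)" and len: "q = length ms + 3"
    and r: "\<not> letter_class q 2 r" and s: "letter_class q 2 s"
    and "r \<noteq> q"
    and nodouble: "\<And>ns r ms. circ ns \<Longrightarrow> length ns = q \<Longrightarrow> mset ns = {#q, q, r#} + mset ms \<Longrightarrow> r = q"
    and pu: "pure (q - 1)"
  shows False
proof -
  define p where "p = q - 1"
  have q2: "q - 2 = p - 1"
    by (simp add: p_def)
  have q3: "q \<noteq> 2"
    using len by simp
  obtain a e where ae: "(a, e) \<in> A q O A r" "(e, a) \<in> word (s # ms)" "d e a \<le> length (s # ms)"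
    "a \<in> V" "e \<in> V"
    by (rule circ_pair[OF c, of q r "s # ms"]) auto
  have ea: "d e a = q - 2"
    using back_dist_ge(1)[OF ae(1)] ae(3) len by simp
  have "d a e \<noteq> 2"
    using r ae(1) S_memI[OF ae(4,5)] ea unfolding letter_class_def by metis
  then have "d a e = 1"
    using two_step_dist_nonzero[OF ae(1) q3] back_dist_ge(3)[OF ae(1)] by simp
  then have arc: "(a, e) \<in> A p"
    using arc_A[OF ae(4,5)] ea len by (simp add: p_def)
  then have Ap: "A p \<noteq> {}"
    by blast
  have c1: "circ (p # s # ms)"
    using circ_append[of "[p]" "s # ms"] arc ae(2) by auto
  have st: "set (p # s # ms) = {p}"
    using pu[unfolded pure_def, rule_format, of "p # s # ms"] c1 len by (simp add: p_def)
  then have "s = p" and ms: "ms = replicate (length ms) p"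
    using replicate_eqI[of ms "length ms" p] by auto
  have "r \<noteq> p"
    using r s \<open>s = p\<close> by auto
  moreover have "2 \<le> r" "r \<le> q"
    using circ_bounds[OF c, of r] len by auto
  \<comment> \<open>With \<open>ms\<close> empty, \<open>q = 3\<close> and \<open>p = 2\<close>
    leave no value for \<open>r\<close>.\<close>
  ultimately have "ms \<noteq> []"
    using len \<open>r \<noteq> q\<close> by (auto simp: p_def)
  then obtain k where k: "length ms = Suc k"
    by (cases ms) auto
  have qk: "q = Suc (Suc (Suc (Suc k)))" "p = Suc (Suc (Suc k))"
    using len k by (auto simp: p_def)
  have msk: "ms = p # replicate k p"
    using ms k by simp
  obtain x z where xz: "(x, z) \<in> A p O A r" "(z, x) \<in> word (q # ms)" "d z x \<le> length (q # ms)"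
    "x \<in> V" "z \<in> V"
    by (rule circ_pair[OF c, of p r "q # ms"]) (use \<open>s = p\<close> in auto)
  have fw: "d x z = 2"
    by (rule circ_pair_fwd[OF xz(2) _ _ xz(1), of q]) (use len in auto)
  have "d z x = p - 1 \<or> d z x = p - 2"
    using back_dist_ge(1)[OF xz(1)] xz(3) len p_def by auto
  then show False
  proof
    assume "d z x = p - 1"
    then have S: "(x, z) \<in> S 2 (q - 2)"
      using S_memI[OF xz(4,5)] fw q2 by simp
    obtain u w where uw: "(u, w) \<in> A q O A p" "(u, w) \<in> S 2 (q - 2)"
      using s \<open>s = p\<close> by (auto simp: letter_class_def)
    then have "(u, w) \<in> A p O A q"
      using regular_commute[of "A p" "A q"] by simp
    then have "A p O A r = A p O A q"
      using A_comp_meet_eq[OF xz(1) S] uw(2) by blast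
    then have "circ (p # q # q # ms)"
      by (intro circ_replace[OF c, of "[p, r]" "[p, q]" "q # ms"]) (use \<open>s = p\<close> in auto)
    then have "p = q"
      using nodouble[of "p # q # q # ms" p ms] len by simp
    then show False
      using qk by simp
  next
    assume "d z x = p - 2"
    then have S: "(x, z) \<in> S 2 (p - 2)"
      using S_memI[OF xz(4,5)] fw by simp
    have cp: "circ (replicate p p)"
      using pure_circ[OF pu] Ap p_def by simp
    \<comment> \<open>Consecutive arcs in the circuit of \<open>p\<close> arcs of type
      \<open>p\<close> are also at two-way distance \<open>(2, p - 2)\<close>.\<close>
    obtain u w where uw: "(u, w) \<in> A p O A p" "(w, u) \<in> word (replicate (Suc k) p)"
      "d w u \<le> length (replicate (Suc k) p)" "u \<in> V" "w \<in> V"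
      by (rule circ_pair[OF cp, of p p "replicate (Suc k) p"]) (simp_all add: qk(2))
    have "d u w = 2"
      by (rule circ_pair_fwd[OF uw(2) _ _ uw(1), of p]) (use qk in auto)
    moreover have "d w u = p - 2"
      using back_dist_ge(1)[OF uw(1)] uw(3) qk by simp
    ultimately have "(u, w) \<in> S 2 (p - 2)"
      using S_memI[OF uw(4,5)] by simp
    then have "(u, w) \<in> A p O A r"
      using regular_meet[OF _ S xz(1)] by auto
    then show False
      using A_meet_square[OF uw(1)] \<open>r \<noteq> p\<close> by auto
  qed
qed

text \<open>Class 1 puts \<open>A p\<close> with \<open>p = q - 1\<close> inside
  \<open>A q O A r\<close>, so in circuits a letter \<open>p\<close> may be expanded to
  \<open>q, r\<close>. Whichever class \<open>p\<close> has, an exchange then places it beside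
  \<open>m = q - 2\<close>, where D(\<open>p\<close>) absorbs it.\<close>

lemma letter_class_excl_D:
  assumes r: "letter_class q 1 r"
    and D: "conf_D (q - 1)"
  shows False
proof -
  define p where "p = q - 1"
  define m where "m = p - 1"
  have q2: "q - 2 = p - 1"
    by (simp add: p_def)
  have D': "conf_D p"
    using D p_def by simp
  obtain k where k: "p = Suc (Suc (Suc k))" and cm: "circ (replicate m m)"
    using conf_cases D' unfolding m_def by metis
  have mk: "m = Suc (Suc k)" "q = Suc (Suc (Suc (Suc k)))"
    using k by (auto simp: m_def p_def)
  have rm: "replicate m m = m # m # replicate k m"
    by (simp add: mk)
  have Ap: "A p \<subseteq> A q O A r" "A p \<noteq> {}"
    using letter_class_sub[OF r] by (auto simp: A_def q2)
  have sub: "A p \<subseteq> F m"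
    using D' by (simp add: conf_D_def m_def)
  have absorb: "A p O A m \<subseteq> A m"
    by (rule conf_D_absorb[OF sub])
  obtain x y where xy: "(x, y) \<in> A p"
    using Ap(2) by auto
  then have "(x, y) \<in> word [q, r]" "(y, x) \<in> F m"
    using Ap(1) sub F_converse[of m] by auto
  then have c1: "circ ([q, r] @ replicate m m)"
    using circ_replicate_append[OF cm, of x y "[q, r]"] mk by blast
  have "letter_class q 1 m \<or> letter_class q 2 m"
    by (rule letter_class_cases[OF c1, of q m "r # m # replicate k m"]) (auto simp: mk)
  moreover have disj: "S i (q - 2) \<inter> F m = {}" if "letter_class q i m" for i
    using that F_disjoint[OF cm, of q] mk unfolding letter_class_def
    by (metis Suc_less_eq numeral_2_eq_2 zero_less_Suc)
  \<comment> \<open>Class 1 for \<open>m\<close> would keep \<open>A p\<close> out of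
    \<open>F m\<close>, against D(\<open>p\<close>).\<close>
  moreover have "\<not> letter_class q 1 m"
    using disj[of 1] xy sub by (auto simp: A_def q2)
  ultimately have m2: "letter_class q 2 m"
    by blast
  have cp: "circ (replicate p p)"
    by (rule conf_D_circ[OF D']) (use disj[OF m2] q2 m_def in simp)
  have c2: "circ (q # r # replicate m p)"
    by (rule circ_replace[OF cp, of "[p]" "[q, r]" "replicate m p"])
      (use Ap in \<open>simp_all add: mk k\<close>)
  have "letter_class q 1 p \<or> letter_class q 2 p"
    by (rule letter_class_cases[OF c2, of q p "r # p # replicate k p"]) (auto simp: mk k)
  then show False
  proof
    assume "letter_class q 1 p"
    then have eq: "A q O A r = A q O A p"
      using letter_class_eq r by blast
    have c3: "circ (q # p # replicate m m)"
      by (rule circ_replace[OF c1, of "[q, r]" "[q, p]" "replicate m m"]) (use eq in auto)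
    have "circ (q # replicate m m)"
      by (rule circ_replace[OF c3, of "[p, m]" "[m]" "q # m # replicate k m"])
        (use absorb in \<open>simp_all add: rm\<close>)
    then show False
      using circ_bounds(2)[of "q # replicate m m" q] mk by simp
  next
    assume "letter_class q 2 p"
    then have eq: "A q O A m = A q O A p"
      using letter_class_eq m2 by blast
    have c3: "circ (q # r # p # m # replicate k m)"
      by (rule circ_replace[OF c1, of "[q, m]" "[q, p]" "r # m # replicate k m"])
        (use eq in \<open>simp_all add: rm\<close>)
    have "circ (q # r # m # replicate k m)"
      by (rule circ_replace[OF c3, of "[p, m]" "[m]" "q # r # replicate k m"])
        (use absorb in simp_all)
    then show False
      using circ_bounds(2)[of "q # r # m # replicate k m" q] mk by simp
  qed
qed

text \<open>Expanding \<open>m\<close> to \<open>p, p\<close> and then one \<open>p\<close> to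
  \<open>q, r\<close> gives a circuit of length \<open>q\<close> with letters \<open>p\<close> and
  \<open>m\<close>. Each of the four combinations of their classes leads to a circuit that is too
  short, or in one case possibly to a second letter \<open>q\<close> or a wrong distance.\<close>

lemma letter_class_excl_C:
  assumes r: "letter_class q 1 r" "\<not> letter_class q 2 r" and "r < q"
    and nodouble: "\<And>ns r ms. circ ns \<Longrightarrow> length ns = q \<Longrightarrow> mset ns = {#q, q, r#} + mset ms \<Longrightarrow> r = q"
    and C: "conf_C (q - 1)"
  shows False
proof -
  define p where "p = q - 1"
  define m where "m = p - 1"
  have q2: "q - 2 = p - 1"
    by (simp add: p_def)
  have C': "conf_C p"
    using C p_def by simp
  obtain k where k: "p = Suc (Suc (Suc k))" and mne: "A m \<noteq> {}" and cm: "circ (replicate m m)"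
    using conf_cases C' unfolding m_def by metis
  have mk: "m = Suc (Suc k)" "q = Suc (Suc (Suc (Suc k)))"
    using k by (auto simp: m_def p_def)
  have rm: "replicate m m = m # m # replicate k m"
    by (simp add: mk)
  have Ap: "A p \<subseteq> A q O A r" "A p \<noteq> {}"
    using letter_class_sub[OF r(1)] by (auto simp: A_def q2)
  have sub: "A m \<subseteq> A p O A p"
    using C' by (simp add: conf_C_def m_def)
  note cube = conf_C_cube[OF sub mne]
  have c1: "circ (p # p # m # replicate k m)"
    by (rule circ_replace[OF cm, of "[m]" "[p, p]" "m # replicate k m"])
      (use sub in \<open>simp_all add: rm\<close>)
  have c2: "circ (q # r # p # m # replicate k m)"
    by (rule circ_replace[OF c1, of "[p]" "[q, r]" "p # m # replicate k m"])
      (use Ap in simp_all)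
  have min: "q \<le> length ns" if "circ ns" "q \<in> set ns" for ns
    using circ_bounds(2) that .
  \<comment> \<open>A letter of both classes would be interchangeable with \<open>r\<close> and
    place \<open>r\<close> in class 2.\<close>
  have excl: False if "letter_class q 1 t" "letter_class q 2 t" for t
    using r that letter_class_eq[of q 1 r t] letter_class_cong[of q r t] by blast
  have pc: "letter_class q 1 p \<or> letter_class q 2 p"
    by (rule letter_class_cases[OF c2, of q p "r # m # replicate k m"]) (auto simp: mk k)
  have mc: "letter_class q 1 m \<or> letter_class q 2 m"
    by (rule letter_class_cases[OF c2, of q m "r # p # replicate k m"]) (auto simp: mk k)
  consider (11) "letter_class q 1 p" "letter_class q 1 m"
    | (12) "letter_class q 1 p" "letter_class q 2 m"
    | (21) "letter_class q 2 p" "letter_class q 1 m"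
    | (22) "letter_class q 2 p" "letter_class q 2 m"
    using pc mc by blast
  then show False
  proof cases
    case 11
    have e1: "A q O A r = A q O A p" and e2: "A q O A m = A q O A p"
      using letter_class_eq r(1) 11 by blast+
    have c3: "circ (q # p # p # m # replicate k m)"
      by (rule circ_replace[OF c2, of "[q, r]" "[q, p]" "p # m # replicate k m"])
        (use e1 in simp_all)
    have c4: "circ (q # p # p # p # replicate k m)"
      by (rule circ_replace[OF c3, of "[q, m]" "[q, p]" "p # p # replicate k m"])
        (use e2 in simp_all)
    have "circ (m # p # q # replicate k m)"
      by (rule circ_replace[OF c4, of "[p, p, p]" "[m, p]" "q # replicate k m"])
        (use cube(3) in simp_all)
    then show False
      using min[of "m # p # q # replicate k m"] mk by simp
  next
    case 12
    have s2: "S 2 (q - 2) \<subseteq> A q O A m" "S 2 (q - 2) \<noteq> {}"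
      using letter_class_sub[OF 12(2)] by auto
    \<comment> \<open>Class 1 of \<open>p\<close> makes the ends of an arc of type \<open>q\<close>
      share an out-neighbour along \<open>A p\<close>, so \<open>A q\<close> lies in
      \<open>F p\<close>.\<close>
    obtain u w where uw: "(u, w) \<in> A q O A p" "(u, w) \<in> A p"
      using 12(1) by (auto simp: letter_class_def A_def q2)
    then obtain v where v: "(u, v) \<in> A q" "(v, w) \<in> A p"
      by auto
    then have "(u, v) \<in> F p"
      using uw(2) by (auto simp: F_def)
    then have qF: "A q \<subseteq> F p"
      using regular_meet_A[OF _ v(1)] by simp
    obtain x t z where xt: "(x, t) \<in> A q" "(t, z) \<in> A m"
      using s2 by fastforce
    have "(t, t) \<in> (A q)\<inverse> O A q"
      using xt by auto
    have "(t, z) \<in> A p O A p"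
      using xt(2) sub by blast
    obtain y where y: "(t, y) \<in> A q"
      using \<open>(t, t) \<in> (A q)\<inverse> O A q\<close> regular_commute[of "(A q)\<inverse>" "A q"] by auto
    have "(y, t) \<in> F p"
      using y qF F_converse[of p] by blast
    \<comment> \<open>Being \<open>F p\<close>-equivalent, \<open>y\<close> and \<open>t\<close>
      have the same successors along \<open>A p O A p\<close>, and \<open>conf_C_square\<close>
      leaves two relations for \<open>(y, z)\<close>.\<close>
    then have "(y, z) \<in> A p O A p"
      using \<open>(t, z) \<in> A p O A p\<close> F_A[of p] by blast
    then have "(y, z) \<in> A m \<union> S 2 (q - 2)"
      using conf_C_square[OF C'] by (auto simp: m_def q2)
    then show False
    proof
      assume "(y, z) \<in> A m"
      then have "(t, y) \<in> F m"
        using xt(2) by (auto simp: F_def)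
      then have "A q \<subseteq> F m"
        using regular_meet_A[OF _ y] by simp
      then have "A q O A m \<subseteq> A m"
        by (rule conf_D_absorb)
      then have "S 2 (q - 2) \<subseteq> A m"
        using s2(1) by blast
      then show False
        using s2(2) S_memD by (fastforce dest: A_memD)
    next
      assume "(y, z) \<in> S 2 (q - 2)"
      then obtain w where w: "(y, w) \<in> A q" "(w, z) \<in> A m"
        using s2(1) by auto
      then have "(w, t) \<in> F m" "(t, w) \<in> word [q, q]"
        using xt(2) y by (auto simp: F_def)
      then have "circ ([q, q] @ replicate m m)"
        using circ_replicate_append[OF cm, of t w "[q, q]"] mk by blast
      then have "m = q"
        by (rule nodouble[of _ m "m # replicate k m"]) (simp_all add: mk)
      then show False
        using mk by simp
    qed
  next
    case 21
    have eq: "A q O A r = A q O A m"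
      using letter_class_eq r(1) 21 by blast
    have c3: "circ (q # m # p # m # replicate k m)"
      by (rule circ_replace[OF c2, of "[q, r]" "[q, m]" "p # m # replicate k m"])
        (use eq in simp_all)
    \<comment> \<open>Now \<open>m\<close> letters \<open>m\<close> are present; \<open>p\<close>
      absorbs the block because \<open>F m\<close> lies in \<open>F p\<close>.\<close>
    have "mset (q # m # p # m # replicate k m) = mset (p # [q]) + replicate_mset m m"
      by (simp add: mk)
    then have "circ [p, q]"
      using circ_absorb[OF cm _ cube(2) c3, of "[q]"] mk by simp
    then show False
      using min[of "[p, q]"] mk by simp
  next
    case 22
    have eq: "A q O A m = A q O A p"
      using letter_class_eq 22 by blast
    have "r \<noteq> p" "r \<noteq> m"
      using 22 r excl by auto
    moreover have "2 \<le> r"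
      using circ_bounds(1)[OF c2, of r] by simp
    \<comment> \<open>For \<open>k = 0\<close>, \<open>q = 4\<close> and \<open>r\<close> could only
      be 2 or 3, that is, \<open>m\<close> or \<open>p\<close>.\<close>
    ultimately have "k \<noteq> 0"
      using \<open>r < q\<close> mk k by auto
    then obtain j where j: "k = Suc j"
      using not0_implies_Suc by blast
    have c3: "circ (q # r # p # p # m # replicate j m)"
      by (rule circ_replace[OF c2, of "[q, m]" "[q, p]" "r # p # replicate k m"])
        (use eq in \<open>simp_all add: j\<close>)
    have c4: "circ (q # r # p # p # p # replicate j m)"
      by (rule circ_replace[OF c3, of "[q, m]" "[q, p]" "r # p # p # replicate j m"])
        (use eq in simp_all)
    have "circ (m # p # q # r # replicate j m)"
      by (rule circ_replace[OF c4, of "[p, p, p]" "[m, p]" "q # r # replicate j m"])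
        (use cube(3) in simp_all)
    then show False
      using min[of "m # p # q # r # replicate j m"] mk j by simp
  qed
qed

section \<open>Equivalence of mixedness and configurations\<close>

lemma mixed_conf:
  "\<not> pure q \<Longrightarrow> conf_C q \<or> conf_D q"
proof (induction q rule: less_induct)
  case (less q)
  note IH = less.IH
  obtain ns where ns: "circ ns" "length ns = q" "q \<in> set ns" "set ns \<noteq> {q}"
    using less.prems by (auto simp: pure_def)
  show ?case
  proof (rule ccontr)
    assume no: "\<not> (conf_C q \<or> conf_D q)"
    have nodouble: "r = q"
      if "circ ns" "length ns = q" "mset ns = {#q, q, r#} + mset ms" for ns r ms
      using double_conf_C[OF that _ IH] no by blast
    obtain n1 n2 where n12: "ns = n1 @ q # n2"
      using ns(3) by (meson split_list)
    define v where "v = n1 @ n2"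
    have c: "circ (q # v)"
      using ns(1) circ_perm[of ns "q # v"] by (simp add: n12 v_def)
    have len: "q = Suc (length v)"
      using ns(2) n12 v_def by simp
    have "\<exists>t\<in>set v. t \<noteq> q"
      using ns(3,4) n12 v_def by auto
    then obtain t where t: "t \<in> set v" "t \<noteq> q"
      by blast
    have nq: "q \<notin> set v"
    proof
      assume "q \<in> set v"
      then obtain v1 v2 where v12: "v = v1 @ q # v2"
        by (meson split_list)
      then have "t \<in> set (v1 @ v2)"
        using t by auto
      then obtain w1 w2 where "v1 @ v2 = w1 @ t # w2"
        by (meson split_list)
      then have "mset (v1 @ v2) = mset (w1 @ t # w2)"
        by (rule arg_cong)
      then have "mset (q # v) = {#q, q, t#} + mset (w1 @ w2)"
        by (simp add: v12)
      from nodouble[OF c _ this] show False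
        using len t(2) by simp
    qed
    have cls: "letter_class q 1 s \<or> letter_class q 2 s" if s: "s \<in> set v" for s
    proof -
      obtain v1 v2 where v12: "v = v1 @ s # v2"
        using s by (meson split_list)
      show ?thesis
        by (rule letter_class_cases[OF c, of q s "v1 @ v2"]) (use len v12 s nq in auto)
    qed
    \<comment> \<open>If all letters were in one class, exchanges would turn them all into
      \<open>t\<close>, the case of \<open>uniform_conf_D\<close>.\<close>
    have nall: "\<exists>s\<in>set v. \<not> letter_class q i s" for i
    proof (rule ccontr)
      assume "\<not> ?thesis"
      then have "A q O A s = A q O A t" if "s \<in> set v" for s
        using letter_class_eq that t(1) by blast
      then have "circ (q # replicate (q - 1) t)"
        using c word_letters_eq[of v q t] len by (simp add: circ_def)
      then show False
        using uniform_conf_D[OF _ t(2) IH] no by blast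
    qed
    obtain r where r: "r \<in> set v" "\<not> letter_class q 2 r" "letter_class q 1 r"
      using nall[of 2] cls by blast
    obtain s where s: "s \<in> set v" "letter_class q 2 s"
      using nall[of 1] cls by blast
    have "r \<noteq> q"
      using r nq by blast
    moreover have "r \<le> q"
      using circ_bounds(2)[OF c, of r] r len by simp
    ultimately have "r < q"
      by simp
    obtain v1 v2 where v12: "v = v1 @ r # v2"
      using r(1) by (meson split_list)
    then have "s \<in> set (v1 @ v2)"
      using s r by auto
    then obtain w1 w2 where w12: "v1 @ v2 = w1 @ s # w2"
      by (meson split_list)
    then have mv: "mset (v1 @ v2) = mset (w1 @ s # w2)"
      by (rule arg_cong)
    have c': "circ (q # r # s # w1 @ w2)"
      using c circ_perm[of "q # v" "q # r # s # w1 @ w2"] mv by (simp add: v12)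
    have len': "q = length (w1 @ w2) + 3"
      using len v12 arg_cong[OF w12, of length] by simp
    have "\<not> pure (q - 1)"
    proof
      assume "pure (q - 1)"
      show False
        by (rule letter_class_excl_pure[OF c' len' r(2) s(2) \<open>r \<noteq> q\<close> _ \<open>pure (q - 1)\<close>])
          (erule (2) nodouble)
    qed
    then have "conf_C (q - 1) \<or> conf_D (q - 1)"
      using IH[of "q - 1"] len by simp
    then show False
    proof
      assume "conf_C (q - 1)"
      show False
        by (rule letter_class_excl_C[OF r(3,2) \<open>r < q\<close> _ \<open>conf_C (q - 1)\<close>])
          (erule (2) nodouble)
    next
      assume "conf_D (q - 1)"
      then show False
        using letter_class_excl_D[OF r(3)] by blast
    qed
  qed
qed

text \<open>Start from the circuit of \<open>q - 1\<close> arcs of type \<open>q - 1\<close>: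
  C(\<open>q\<close>) replaces one arc by two of type \<open>q\<close>, and D(\<open>q\<close>)
  inserts an arc of type \<open>q\<close>. Either way the length is \<open>q\<close> and both types
  occur.\<close>

lemma conf_mixed:
  assumes CD: "conf_C q \<or> conf_D q"
  shows "\<not> pure q"
proof -
  obtain k where k: "q = Suc (Suc (Suc k))" and cp: "circ (replicate (q - 1) (q - 1))"
    using conf_cases[OF CD] by metis
  have "\<exists>ns. circ ns \<and> length ns = q \<and> q \<in> set ns \<and> q - 1 \<in> set ns"
    using CD
  proof
    assume "conf_C q"
    then have "circ (q # q # replicate (Suc k) (q - 1))"
      by (intro circ_replace[OF cp, of "[q - 1]" "[q, q]" "replicate (Suc k) (q - 1)"])
        (simp_all add: k conf_C_def)
    then show ?thesis
      by (intro exI[of _ "q # q # replicate (Suc k) (q - 1)"]) (simp add: k)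
  next
    assume D: "conf_D q"
    then obtain x y where "(x, y) \<in> A q" "(y, x) \<in> F (q - 1)"
      using F_converse[of "q - 1"] by (fastforce simp: conf_D_def)
    then have "circ ([q] @ replicate (q - 1) (q - 1))"
      using circ_replicate_append[OF cp, of x y "[q]"] k by simp
    then show ?thesis
      by (intro exI[of _ "[q] @ replicate (q - 1) (q - 1)"]) (simp add: k)
  qed
  then obtain ns where "circ ns" "length ns = q" "q \<in> set ns" "q - 1 \<in> set ns"
    by blast
  then show ?thesis
    unfolding pure_def using k by (metis diff_Suc_1 n_not_Suc_n singletonD)
qed

end

section \<open>Intersection numbers and directed distance in digraphs\<close>

text \<open>A pair outside \<open>tdists G\<close> has an empty relation, in agreement with the
  default value 0; finiteness of the vertex set makes a nonempty count nonzero.\<close>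

lemma inter_num_nonzero_iff:
  assumes "weakly_distance_regular G"
  shows "inter_num G h i j \<noteq> 0 \<longleftrightarrow> trel G h \<inter> trel G i O trel G j \<noteq> {}"
proof
  interpret pair_digraph G
    using assms by (simp add: weakly_distance_regular_def)
  assume "trel G h \<inter> trel G i O trel G j \<noteq> {}"
  then obtain x y z where xyz: "(x, y) \<in> trel G h" "(x, z) \<in> trel G i" "(z, y) \<in> trel G j"
    by auto
  then have "i \<in> tdists G" "j \<in> tdists G"
    by (auto simp: trel_def tdists_def)
  then have "inter_num G h i j = num_between G i j x y"
    using inter_num_eq[OF assms _ _ xyz(1)] by simp
  moreover have "z \<in> {z \<in> pverts G. tdist G x z = i \<and> tdist G z y = j}"
    using xyz by (simp add: trel_def)
  ultimately show "inter_num G h i j \<noteq> 0"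
    unfolding num_between_def using finite_verts by (auto simp: card_eq_0_iff)
next
  assume nz: "inter_num G h i j \<noteq> 0"
  then have ij: "h \<in> tdists G" "i \<in> tdists G" "j \<in> tdists G"
    by (auto simp: inter_num_def split: if_splits)
  then obtain x y where xy: "(x, y) \<in> trel G h"
    by (auto simp: tdists_def trel_def)
  then have "num_between G i j x y \<noteq> 0"
    using nz inter_num_eq[OF assms ij(2,3) xy] by simp
  then obtain z where "z \<in> pverts G" "tdist G x z = i" "tdist G z y = j"
    unfolding num_between_def by (metis (mono_tags, lifting) Collect_empty_eq card.empty)
  then have "(x, z) \<in> trel G i" "(z, y) \<in> trel G j"
    using xy by (auto simp: trel_def)
  then show "trel G h \<inter> trel G i O trel G j \<noteq> {}"
    using xy by blast
qed

locale strong_pair_digraph = pair_digraph G for G :: "'a pair_pre_digraph" +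
  assumes strong: "strongly_connected (with_proj G)"
begin

lemma ddist_le: "awalk x p y \<Longrightarrow> ddist G x y \<le> length p"
  unfolding ddist_def by (rule Least_le) blast

lemma ddist_awalk:
  assumes "x \<in> pverts G" "y \<in> pverts G"
  obtains p where "awalk x p y" "length p = ddist G x y"
proof -
  have "x \<rightarrow>\<^sup>*\<^bsub>with_proj G\<^esub> y"
    using assms strong by (auto simp: strongly_connected_def)
  then have "\<exists>n p. awalk x p y \<and> length p = n"
    by (auto simp: reachable_awalk)
  then have "\<exists>p. awalk x p y \<and> length p = ddist G x y"
    unfolding ddist_def by (rule LeastI_ex)
  then show ?thesis
    using that by blast
qed

lemma ddist_eq_0_iff:
  assumes "x \<in> pverts G" "y \<in> pverts G"
  shows "ddist G x y = 0 \<longleftrightarrow> x = y"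
proof
  assume "ddist G x y = 0"
  then show "x = y"
    using ddist_awalk[OF assms] by (metis awalk_Nil_iff length_0_conv)
qed (use assms ddist_self in auto)

lemma ddist_arc: "e \<in> parcs G \<Longrightarrow> ddist G (fst e) (snd e) = 1"
proof -
  assume e: "e \<in> parcs G"
  then have V: "fst e \<in> pverts G" "snd e \<in> pverts G" and ne: "fst e \<noteq> snd e"
    using wellformed[of e] no_loops[of e] by auto
  have "ddist G (fst e) (snd e) \<le> 1"
    using ddist_le[OF arc_implies_awalk[of e]] e by simp
  moreover have "ddist G (fst e) (snd e) \<noteq> 0"
    using ddist_eq_0_iff V ne by blast
  ultimately show ?thesis
    by simp
qed

lemma ddist_triangle:
  assumes "x \<in> pverts G" "y \<in> pverts G" "z \<in> pverts G"
  shows "ddist G x z \<le> ddist G x y + ddist G y z"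
proof -
  obtain p where "awalk x p y" "length p = ddist G x y"
    using ddist_awalk assms by blast
  moreover obtain p' where "awalk y p' z" "length p' = ddist G y z"
    using ddist_awalk assms by blast
  ultimately show ?thesis
    using ddist_le[of x "p @ p'" z] awalk_appendI by fastforce
qed

lemma ddist_first_step:
  assumes "x \<in> pverts G" "y \<in> pverts G" "ddist G x y = Suc n"
  shows "\<exists>z\<in>pverts G. (x, z) \<in> parcs G \<and> ddist G z y = n"
proof -
  obtain p where "awalk x p y" "length p = Suc n"
    using ddist_awalk[OF assms(1,2)] assms(3) by metis
  then obtain e p' where p': "e \<in> parcs G" "fst e = x" "awalk (snd e) p' y" "length p' = n"
    by (cases p) (auto simp: awalk_Cons_iff)
  have V: "snd e \<in> pverts G"
    using wellformed p' by auto
  have "Suc n \<le> 1 + ddist G (snd e) y"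
    using ddist_triangle[OF assms(1) V assms(2)] assms(3) ddist_arc p' by fastforce
  then have "ddist G (snd e) y = n"
    using ddist_le[OF p'(3)] p'(4) by simp
  then show ?thesis
    using p'(1,2) V by (metis prod.collapse)
qed

end

section \<open>Digraphs as instances of the abstract setting\<close>

locale thick_commutative_wdr =
  fixes G :: "'a pair_pre_digraph"
  assumes wdr: "weakly_distance_regular G"
    and commutative: "commutative_wdr G"
    and thick: "thick_wdr G"

sublocale thick_commutative_wdr \<subseteq> strong_pair_digraph
  using wdr by (auto simp: weakly_distance_regular_def strong_pair_digraph_def
      strong_pair_digraph_axioms_def)

context thick_commutative_wdr
begin

lemma two_way_trel: "two_way (pverts G) (ddist G) a b = trel G (int a, int b)"
  by (auto simp: two_way_def trel_def tdist_def)

lemma trel_regular: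
  assumes "trel G h \<inter> trel G i O trel G j \<noteq> {}"
  shows "trel G h \<subseteq> trel G i O trel G j"
proof
  fix e assume e: "e \<in> trel G h"
  have "inter_num G h i j \<noteq> 0"
    using assms inter_num_nonzero_iff[OF wdr] by blast
  then have ij: "i \<in> tdists G" "j \<in> tdists G"
    by (auto simp: inter_num_def split: if_splits)
  obtain x y where xy: "e = (x, y)"
    by fastforce
  then have "num_between G i j x y \<noteq> 0"
    using \<open>inter_num G h i j \<noteq> 0\<close> inter_num_eq[OF wdr ij] e by metis
  then obtain z where "z \<in> pverts G" "tdist G x z = i" "tdist G z y = j"
    unfolding num_between_def by (metis (mono_tags, lifting) Collect_empty_eq card.empty)
  then show "e \<in> trel G i O trel G j"
    using e xy by (auto simp: trel_def)
qed

lemma trel_commute: "trel G i O trel G j \<subseteq> trel G j O trel G i"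
proof
  fix e assume e: "e \<in> trel G i O trel G j"
  obtain x y where xy: "e = (x, y)"
    by fastforce
  have "x \<in> pverts G" "y \<in> pverts G"
    using e xy by (auto simp: trel_def)
  then have h: "e \<in> trel G (tdist G x y)"
    by (simp add: xy trel_def)
  then have nz: "inter_num G (tdist G x y) i j \<noteq> 0"
    using e inter_num_nonzero_iff[OF wdr] by blast
  then have "inter_num G (tdist G x y) j i \<noteq> 0"
    using commutative by (auto simp: commutative_wdr_def inter_num_def split: if_splits)
  then have "trel G (tdist G x y) \<subseteq> trel G j O trel G i"
    using inter_num_nonzero_iff[OF wdr] trel_regular by blast
  then show "e \<in> trel G j O trel G i"
    using h by blast
qed

text \<open>The common out-neighbour \<open>z\<close> makes an intersection number nonzero, hence
  equal to the valency. So the common neighbours of \<open>x\<close> and \<open>y\<close> exhaust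
  the neighbours of \<open>x\<close>.\<close>

lemma trel_thick:
  assumes xz: "(x, z) \<in> trel G i" and yz: "(y, z) \<in> trel G i" and xw: "(x, w) \<in> trel G i"
  shows "(y, w) \<in> trel G i"
proof -
  have V: "x \<in> pverts G" "y \<in> pverts G" "z \<in> pverts G"
    using xz yz by (auto simp: trel_def)
  have sw: "tdist G a b = prod.swap i \<longleftrightarrow> tdist G b a = i" for a b
    by (cases i) (auto simp: tdist_def)
  have h: "(x, y) \<in> trel G (tdist G x y)"
    using V by (simp add: trel_def)
  have "(z, y) \<in> trel G (prod.swap i)"
    using yz by (simp add: trel_def sw)
  then have nz: "inter_num G (tdist G x y) i (prod.swap i) \<noteq> 0"
    using h xz inter_num_nonzero_iff[OF wdr] by blast
  then have td: "tdist G x y \<in> tdists G" "i \<in> tdists G" "prod.swap i \<in> tdists G"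
    by (auto simp: inter_num_def split: if_splits)
  then have "inter_num G (tdist G x y) i (prod.swap i) = valency G i"
    using bspec[OF bspec[OF thick[unfolded thick_wdr_def] td(1)] td(2)] nz by simp
  moreover have "{z \<in> pverts G. tdist G x z = i \<and> tdist G z y = prod.swap i}
      = trel_nbrs G i x \<inter> trel_nbrs G i y"
    using V by (auto simp: trel_nbrs_def trel_def sw)
  ultimately have "card (trel_nbrs G i x \<inter> trel_nbrs G i y) = card (trel_nbrs G i x)"
    using inter_num_eq[OF wdr td(2,3) h] valency_eq[OF wdr td(2) V(1)]
    by (simp add: num_between_def)
  moreover have "finite (trel_nbrs G i x)"
    by (rule finite_subset[OF _ finite_verts]) (auto simp: trel_nbrs_def trel_def)
  ultimately have "trel_nbrs G i x \<inter> trel_nbrs G i y = trel_nbrs G i x"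
    by (intro card_subset_eq) auto
  then show ?thesis
    using xw by (auto simp: trel_nbrs_def)
qed

sublocale thick_distance "pverts G" "ddist G"
proof
  show "ddist G x y = 0 \<longleftrightarrow> x = y" if "x \<in> pverts G" "y \<in> pverts G" for x y
    using ddist_eq_0_iff that .
  show "ddist G x z \<le> ddist G x y + ddist G y z"
    if "x \<in> pverts G" "y \<in> pverts G" "z \<in> pverts G" for x y z
    using ddist_triangle that .
  show "\<exists>z\<in>pverts G. ddist G x z = 1 \<and> ddist G z y = n"
    if "x \<in> pverts G" "y \<in> pverts G" "ddist G x y = Suc n" for x y n
    using ddist_first_step[OF that] ddist_arc by fastforce
qed (use trel_regular trel_commute trel_thick in \<open>unfold two_way_trel, blast+\<close>)

section \<open>Translation of arcs, circuits, purity and configurations\<close>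

lemma arc_type_iff: "arc_type G (int n) e \<longleftrightarrow> e \<in> A n"
proof
  assume "arc_type G (int n) e"
  then have e: "e \<in> parcs G" "n = Suc (ddist G (snd e) (fst e))"
    by (auto simp: arc_type_def)
  then show "e \<in> A n"
    using arc_A[of "fst e" "snd e"] ddist_arc[of e] wellformed[of e] by simp
next
  assume e: "e \<in> A n"
  obtain x y where xy: "e = (x, y)"
    by fastforce
  note m = A_memD[OF e[unfolded xy]]
  obtain z where z: "z \<in> pverts G" "(x, z) \<in> parcs G" "ddist G z y = 0"
    using ddist_first_step[of x y 0] m by auto
  then have "(x, y) \<in> parcs G"
    using ddist_eq_0_iff m by blast
  then show "arc_type G (int n) e"
    using m xy by (auto simp: arc_type_def)
qed

lemma word_awalk:
  "(x, y) \<in> word ns \<longleftrightarrow> (\<exists>p. awalk x p y \<and> list_all2 (\<lambda>e n. e \<in> A n) p ns)"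
proof (induction ns arbitrary: x)
  case Nil
  then show ?case
    by (auto simp: awalk_Nil_iff)
next
  case (Cons n ns)
  have arc: "e \<in> parcs G" if "e \<in> A n" for e
    using that arc_type_iff[of n e] by (simp add: arc_type_def)
  show ?case
  proof
    assume "(x, y) \<in> word (n # ns)"
    then obtain z p where "(x, z) \<in> A n" "awalk z p y" "list_all2 (\<lambda>e n. e \<in> A n) p ns"
      using Cons.IH by auto
    then show "\<exists>p. awalk x p y \<and> list_all2 (\<lambda>e n. e \<in> A n) p (n # ns)"
      using arc by (intro exI[of _ "(x, z) # p"]) (auto simp: awalk_Cons_iff)
  next
    assume "\<exists>p. awalk x p y \<and> list_all2 (\<lambda>e n. e \<in> A n) p (n # ns)"
    then obtain e p where "awalk x (e # p) y" "e \<in> A n" "list_all2 (\<lambda>e n. e \<in> A n) p ns"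
      by (auto simp: list_all2_Cons2)
    then have "(snd e, y) \<in> word ns" "(x, snd e) \<in> A n"
      using Cons.IH by (auto simp: awalk_Cons_iff)
    then show "(x, y) \<in> word (n # ns)"
      by auto
  qed
qed

lemma circ_circuit:
  "circ ns \<longleftrightarrow> (\<exists>p. circuit G p \<and> list_all2 (\<lambda>e n. e \<in> A n) p ns)"
  unfolding circ_def circuit_def word_awalk by blast

text \<open>Each arc lies in exactly one \<open>A n\<close>, so a circuit and its word of types
  determine each other's purity.\<close>

lemma pure_type_iff: "pure_type G (int n) \<longleftrightarrow> pure n"
proof
  assume P: "pure_type G (int n)"
  show "pure n"
    unfolding pure_def
  proof (intro allI impI)
    fix ns assume ns: "circ ns \<and> length ns = n \<and> n \<in> set ns"
    then obtain p where p: "circuit G p" "list_all2 (\<lambda>e n. e \<in> A n) p ns"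
      using circ_circuit by blast
    have len: "length p = n"
      using p(2) ns list_all2_lengthD by blast
    obtain i where i: "i < n" "ns ! i = n"
      using ns by (metis in_set_conv_nth)
    then have "p ! i \<in> A n" "p ! i \<in> set p"
      using list_all2_nthD2[OF p(2)] ns len by auto
    then have "pure_arc G (int n) (p ! i)"
      using P arc_type_iff unfolding pure_type_def by blast
    then have all: "f \<in> A n" if "f \<in> set p" for f
      using p(1) len \<open>p ! i \<in> set p\<close> that arc_type_iff by (auto simp: pure_arc_def)
    have "m = n" if "m \<in> set ns" for m
    proof -
      obtain j where j: "j < n" "ns ! j = m"
        using \<open>m \<in> set ns\<close> ns by (metis in_set_conv_nth)
      then have "p ! j \<in> A m" "p ! j \<in> A n"
        using list_all2_nthD2[OF p(2)] all ns len by auto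
      then show ?thesis
        using A_unique by (metis prod.collapse)
    qed
    then show "set ns = {n}"
      using ns by auto
  qed
next
  assume P: "pure n"
  show "pure_type G (int n)"
    unfolding pure_type_def pure_arc_def
  proof (intro allI impI ballI)
    fix e p f
    assume e: "arc_type G (int n) e"
      and p: "circuit G p \<and> int (length p) = int n \<and> e \<in> set p" and f: "f \<in> set p"
    define ns where "ns = map (\<lambda>e. Suc (ddist G (snd e) (fst e))) p"
    have "e \<in> parcs G" if "e \<in> set p" for e
      using p that by (auto simp: circuit_def awalk_def)
    then have t: "g \<in> A (Suc (ddist G (snd g) (fst g)))" if "g \<in> set p" for g
      using that arc_type_iff[symmetric] by (simp add: arc_type_def)
    then have "list_all2 (\<lambda>e n. e \<in> A n) p ns"
      by (auto simp: ns_def list_all2_conv_all_nth)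
    then have "circ ns"
      using circ_circuit p by blast
    moreover have "n \<in> set ns"
    proof -
      have "n = Suc (ddist G (snd e) (fst e))"
        using e by (auto simp: arc_type_def)
      then show ?thesis
        using p by (auto simp: ns_def)
    qed
    moreover have "length ns = n"
      using p by (simp add: ns_def)
    ultimately have "set ns = {n}"
      using P unfolding pure_def by blast
    then have "Suc (ddist G (snd f) (fst f)) = n"
      using f by (auto simp: ns_def)
    then show "arc_type G (int n) f"
      using t[OF f] arc_type_iff by simp
  qed
qed

lemma trel_A: "int n = q \<Longrightarrow> n > 0 \<Longrightarrow> trel G (1, q - 1) = A n"
  unfolding A_def two_way_trel by (rule arg_cong[of _ _ "trel G"]) auto

lemma inter_num_meet:
  assumes "trel G h = A a" "trel G i = X" "trel G j = Y" "regular X" "regular Y"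
  shows "inter_num G h i j \<noteq> 0 \<longleftrightarrow> A a \<noteq> {} \<and> A a \<subseteq> X O Y"
  unfolding inter_num_nonzero_iff[OF wdr] assms(1-3)
  using regular_meet_A[of "X O Y" _ _ a] regular_comp[OF assms(4,5)] by blast

lemma config_iff:
  assumes "q = int n" "n \<ge> 2"
  shows "config_C G q \<longleftrightarrow> conf_C n" "config_D G q \<longleftrightarrow> conf_D n"
proof -
  have q: "trel G (1, q - 1) = A n" "trel G (1, q - 2) = A (n - 1)"
    using trel_A[of n q] trel_A[of "n - 1" "q - 1"] assms by (auto simp: of_nat_diff)
  have sw: "trel G (q - 2, 1) = (A (n - 1))\<inverse>"
    unfolding q(2)[symmetric] by (auto simp: trel_def tdist_def)
  have p: "pure_type G (q - 1) \<longleftrightarrow> pure (n - 1)"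
    using pure_type_iff[of "n - 1"] assms by (simp add: of_nat_diff)
  show "config_C G q \<longleftrightarrow> conf_C n"
    unfolding config_C_def conf_C_def p
    using inter_num_meet[OF q(2) q(1) q(1)] by simp
  show "config_D G q \<longleftrightarrow> conf_D n"
    unfolding config_D_def conf_D_def p F_def
    using inter_num_meet[OF q(1) q(2) sw] by simp
qed

text \<open>Here \<open>q - 2\<close> is negative, so \<open>(1, q - 2)\<close> is no two-way
  distance and the intersection numbers take the default 0. Purity is vacuous, since the return
  distance of an arc is at least 1.\<close>

lemma config_small:
  assumes "q < 2"
  shows "\<not> config_C G q" "\<not> config_D G q" "pure_type G q"
proof -
  have "(1, q - 2) \<notin> tdists G"
    using assms by (auto simp: tdists_def tdist_def)
  then show "\<not> config_C G q" "\<not> config_D G q"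
    by (auto simp: config_C_def config_D_def inter_num_def)
  have "\<not> arc_type G q e" for e
  proof
    assume e: "arc_type G q e"
    then have "q = int (nat q)"
      by (auto simp: arc_type_def)
    then have "e \<in> A (nat q)"
      using e arc_type_iff by metis
    then show False
      using A_memD[of "fst e" "snd e" "nat q"] assms by auto
  qed
  then show "pure_type G q"
    by (simp add: pure_type_def)
qed

end

theorem theorem3p1:
  fixes G :: "'a pair_pre_digraph" and q :: int
  assumes "weakly_distance_regular G"
    and "commutative_wdr G"
    and "thick_wdr G"
  shows "config_C G q \<or> config_D G q \<longleftrightarrow> mixed_type G q"
proof -
  interpret thick_commutative_wdr G
    using assms by unfold_locales
  show ?thesis
  proof (cases "q < 2")
    case True
    then show ?thesis
      using config_small by (simp add: mixed_type_def)
  next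
    case False
    then obtain n where n: "q = int n" "n \<ge> 2"
      using that[of "nat q"] by simp
    show ?thesis
      unfolding config_iff[OF n] mixed_type_def
      using n(1) pure_type_iff mixed_conf conf_mixed by blast
  qed
qed

end
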